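(* There exists a unique allocation map $\Phi$, that is, a unique family of maps $\Phi=(\Phi_i)_{i\in N}:\mathcal G_N\times 2^N\to\mathbb{R}^{n}$ ($n=|N|$), one for each finite player set $N\in\mathcal N$, which satisfies properties A1, A2, A3, A4, A5 for all $N\in\mathcal N$ and $\Phi(v,\emptyset)=\mathbf 0$ for all $v\in\mathcal G_N$. Moreover, this map is represented by the average path integral $$\Phi_i(v,T)=\mathbb{E}\Bigl[\sum_{t=1}^{\tau_T}\partial_i v(X_{t-1},X_t)\Bigr],\qquad v\in\mathcal G_N,\ i\in N,\ T\subseteq N.$$
   Context: Player sets: fix a countably infinite set $\mathcal U$ (the universe of players), and let $\mathcal N$ be the set of all finite subsets of $\mathcal U$. For $N\in\mathcal N$, $\mathcal G_N=\{v:2^N\to\mathbb{R} : v(\emptyset)=0\}$ is the set of coalition games on $N$, and $n=|N|$. Coalition game graph: for given $N$, the vertices are the subsets of $N$; the forward edges are $\mathcal E=\{(S,S\cup\{i\}) : i\in N,\ S\subseteq N\setminus\{i\}\}$; the reverse edges are $\mathcal E_-=\{(S\cup\{i\},S) : i\in N,\ S\subseteq N\setminus\{i\}\}$; and $\overline{\mathcal E}=\mathcal E\cup\mathcal E_-$. Write $S\sim T$ if $(S,T)\in\overline{\mathcal E}$. Partial differential: for $v\in\mathcal G_N$ and $i\in N$, $\partial_i v:\overline{\mathcal E}\to\mathbb{R}$ is defined by $\partial_i v(S,S\cup\{j\})=v(S\cup\{i\})-v(S)$ if $j=i$ and $=0$ if $j\ne i$ (for $S\subseteq N\setminus\{j\}$),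 and $\partial_i v(S\cup\{j\},S)=-\partial_i v(S,S\cup\{j\})$. Random coalition process: $(X_t)_{t\ge0}$ is the Markov chain on $2^N$ with $X_0=\emptyset$ and transition probabilities $p_{S,T}=1/n$ if $T\sim S$ and $0$ otherwise. $\tau_T=\min\{t\ge1 : X_t=T\}$ is the first time $t\ge 1$ at which the process visits $T$. Notation: for $i,j\in N$ and $S\subseteq N$, $S^{ij}$ is obtained by switching $i$ and $j$ in $S$: $S^{ij}=S$ if $S\subseteq N\setminus\{i,j\}$ or $\{i,j\}\subseteq S$; $S^{ij}=(S\cup\{i\})\setminus\{j\}$ if $i\notin S$, $j\in S$; $S^{ij}=(S\cup\{j\})\setminus\{i\}$ if $j\notin S$, $i\in S$. For $v\in\mathcal G_N$, $v^{ij}\in\mathcal G_N$ is defined by $v^{ij}(S)=v(S^{ij})$. For $v\in\mathcal G_N$ and $i\in N$, $v_{-i}\in\mathcal G_{N\setminus\{i\}}$ is the restriction of $v$ to $2^{N\setminus\{i\}}$. Properties: A1 (efficiency): $v(S)=\sum_{i\in N}\Phi_i(v,S)$ for all $v\in\mathcal G_N$ and $S\subseteq N$. A2 (linearity): $\Phi_i(\alpha v+\alpha'v',S)=\alpha\Phi_i(v,S)+\alpha'\Phi_i(v',S)$ for all $v,v'\in\mathcal G_N$, $\alpha,\alpha'\in\mathbb{R}$, $S\subseteq N$ and $i\in N$. A3 (symmetry): $\Phi_i(v^{ij},S^{ij})=\Phi_j(v,S)$ for all $v\in\mathcal G_N$, $i,j\in N$ and $S\subseteq N$. A4 (null-player):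 for all $v\in\mathcal G_N$ and $i\in N$, if $\partial_i v\equiv0$, then $\Phi_j(v,S\cup\{i\})=\Phi_j(v,S)=\Phi_j(v_{-i},S)$ for all $j\in N\setminus\{i\}$ and $S\subseteq N\setminus\{i\}$. (Here $\Phi_j(v_{-i},S)$ refers to the map for the player set $N\setminus\{i\}$.) A5 (reflection): for all $v\in\mathcal G_N$, $i\in N$ and $S,T\subseteq N\setminus\{i\}$, $\Phi_i(v,T\cup\{i\})-\Phi_i(v,S\cup\{i\})=-\bigl(\Phi_i(v,T)-\Phi_i(v,S)\bigr)$. (For $N=\emptyset$ there are no components $\Phi_i$, so the representation formula concerns nonempty $N$.) *)

theory Defs
  imports "HOL-Probability.Probability"
begin

section \<open>Coalition games\<close>

text \<open>
  A game on \<open>N\<close> is a function on \<^term>\<open>Pow N\<close>, represented canonically by fixing its value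
  outside \<^term>\<open>Pow N\<close> to \<^term>\<open>undefined\<close>. The set of finite player sets over a universe
  \<open>U\<close> is \<^term>\<open>Fpow U\<close>.
\<close>

definition games :: "'u set \<Rightarrow> ('u set \<Rightarrow> real) set" where
  "games N = {v \<in> Pow N \<rightarrow>\<^sub>E UNIV. v {} = 0}"

definition lin_comb ::
    "'u set \<Rightarrow> real \<Rightarrow> ('u set \<Rightarrow> real) \<Rightarrow> real \<Rightarrow> ('u set \<Rightarrow> real) \<Rightarrow> 'u set \<Rightarrow> real" where
  "lin_comb N \<alpha> v \<alpha>' v' = (\<lambda>S\<in>Pow N. \<alpha> * v S + \<alpha>' * v' S)"

definition switch :: "'u \<Rightarrow> 'u \<Rightarrow> 'u set \<Rightarrow> 'u set" where
  "switch i j S =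
     (if i \<notin> S \<and> j \<in> S then (S \<union> {i}) - {j}
      else if j \<notin> S \<and> i \<in> S then (S \<union> {j}) - {i}
      else S)"

definition switch_game :: "'u set \<Rightarrow> 'u \<Rightarrow> 'u \<Rightarrow> ('u set \<Rightarrow> real) \<Rightarrow> 'u set \<Rightarrow> real" where
  "switch_game N i j v = (\<lambda>S\<in>Pow N. v (switch i j S))"

definition remove_player :: "'u set \<Rightarrow> 'u \<Rightarrow> ('u set \<Rightarrow> real) \<Rightarrow> 'u set \<Rightarrow> real" where
  "remove_player N i v = restrict v (Pow (N - {i}))"


section \<open>The coalition game graph\<close>

definition forward_edges :: "'u set \<Rightarrow> ('u set \<times> 'u set) set" where
  "forward_edges N = {(S, S \<union> {i}) | i S. i \<in> N \<and> S \<subseteq> N - {i}}"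

definition reverse_edges :: "'u set \<Rightarrow> ('u set \<times> 'u set) set" where
  "reverse_edges N = {(S \<union> {i}, S) | i S. i \<in> N \<and> S \<subseteq> N - {i}}"

definition edges :: "'u set \<Rightarrow> ('u set \<times> 'u set) set" where
  "edges N = forward_edges N \<union> reverse_edges N"

text \<open>
  Only the values on \<^term>\<open>edges N\<close> matter; edges adding or removing a player other than \<open>i\<close>
  fall under the last case.
\<close>

definition partial_diff :: "'u \<Rightarrow> ('u set \<Rightarrow> real) \<Rightarrow> 'u set \<Rightarrow> 'u set \<Rightarrow> real" where
  "partial_diff i v S T =
     (if i \<notin> S \<and> T = S \<union> {i} then v (S \<union> {i}) - v S
      else if i \<notin> T \<and> S = T \<union> {i} then - (v (T \<union> {i}) - v T)
      else 0)"


section \<open>The random coalition process\<close>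

definition trans_prob :: "'u set \<Rightarrow> 'u set \<Rightarrow> 'u set \<Rightarrow> real" where
  "trans_prob N S T = (if (S, T) \<in> edges N then 1 / real (card N) else 0)"

text \<open>
  \<open>X\<close> is a Markov chain on \<^term>\<open>Pow N\<close>, on an arbitrary probability space \<open>M\<close>, started at the
  empty coalition. The Markov property is required for every history \<open>s 0, \<dots>, s t\<close> of positive
  probability.
\<close>

definition random_coalition_process ::
    "'a measure \<Rightarrow> 'u set \<Rightarrow> (nat \<Rightarrow> 'a \<Rightarrow> 'u set) \<Rightarrow> bool" where
  "random_coalition_process M N X \<longleftrightarrow>
     prob_space M \<and>
     (\<forall>t. X t \<in> M \<rightarrow>\<^sub>M count_space (Pow N)) \<and>
     (AE \<omega> in M. X 0 \<omega> = {}) \<and>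
     (\<forall>t s T. T \<subseteq> N \<longrightarrow> \<P>(\<omega> in M. \<forall>k\<le>t. X k \<omega> = s k) > 0 \<longrightarrow>
        \<P>(\<omega> in M. X (Suc t) \<omega> = T \<bar> \<forall>k\<le>t. X k \<omega> = s k) = trans_prob N (s t) T)"

text \<open>
  The infimum of the empty set of naturals is \<open>0\<close>; this only concerns the null event that \<open>T\<close> is
  never visited, on which the path sum below is empty.
\<close>

definition first_visit :: "(nat \<Rightarrow> 'a \<Rightarrow> 'u set) \<Rightarrow> 'u set \<Rightarrow> 'a \<Rightarrow> nat" where
  "first_visit X T \<omega> = Inf {t. 1 \<le> t \<and> X t \<omega> = T}"

definition path_sum ::
    "(nat \<Rightarrow> 'a \<Rightarrow> 'u set) \<Rightarrow> 'u \<Rightarrow> ('u set \<Rightarrow> real) \<Rightarrow> 'u set \<Rightarrow> 'a \<Rightarrow> real" where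
  "path_sum X i v T \<omega> =
     (\<Sum>t = 1..first_visit X T \<omega>. partial_diff i v (X (t - 1) \<omega>) (X t \<omega>))"


section \<open>Allocation maps and their properties\<close>

text \<open>
  \<open>\<Phi> N (v, S) i\<close> is the component \<open>\<Phi>\<^sub>i(v, S)\<close> of the map for the player set \<open>N\<close>. Extensionality
  in all arguments makes equality of families coincide with equality on the intended domains.
\<close>

type_synonym 'u alloc = "'u set \<Rightarrow> ('u set \<Rightarrow> real) \<times> 'u set \<Rightarrow> 'u \<Rightarrow> real"

definition alloc_maps :: "'u set \<Rightarrow> 'u alloc set" where
  "alloc_maps U = (\<Pi>\<^sub>E N\<in>Fpow U. games N \<times> Pow N \<rightarrow>\<^sub>E (N \<rightarrow>\<^sub>E UNIV))"

definition efficiency :: "'u alloc \<Rightarrow> 'u set \<Rightarrow> bool" where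
  "efficiency \<Phi> N \<longleftrightarrow>
     (\<forall>v\<in>games N. \<forall>S\<subseteq>N. v S = (\<Sum>i\<in>N. \<Phi> N (v, S) i))"

definition linearity :: "'u alloc \<Rightarrow> 'u set \<Rightarrow> bool" where
  "linearity \<Phi> N \<longleftrightarrow>
     (\<forall>v\<in>games N. \<forall>v'\<in>games N. \<forall>\<alpha> \<alpha>'. \<forall>S\<subseteq>N. \<forall>i\<in>N.
        \<Phi> N (lin_comb N \<alpha> v \<alpha>' v', S) i = \<alpha> * \<Phi> N (v, S) i + \<alpha>' * \<Phi> N (v', S) i)"

definition symmetry :: "'u alloc \<Rightarrow> 'u set \<Rightarrow> bool" where
  "symmetry \<Phi> N \<longleftrightarrow>
     (\<forall>v\<in>games N. \<forall>i\<in>N. \<forall>j\<in>N. \<forall>S\<subseteq>N.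
        \<Phi> N (switch_game N i j v, switch i j S) i = \<Phi> N (v, S) j)"

definition null_player :: "'u alloc \<Rightarrow> 'u set \<Rightarrow> bool" where
  "null_player \<Phi> N \<longleftrightarrow>
     (\<forall>v\<in>games N. \<forall>i\<in>N. (\<forall>(S, T)\<in>edges N. partial_diff i v S T = 0) \<longrightarrow>
        (\<forall>j\<in>N - {i}. \<forall>S\<subseteq>N - {i}.
           \<Phi> N (v, S \<union> {i}) j = \<Phi> N (v, S) j \<and>
           \<Phi> N (v, S) j = \<Phi> (N - {i}) (remove_player N i v, S) j))"

definition reflection :: "'u alloc \<Rightarrow> 'u set \<Rightarrow> bool" where
  "reflection \<Phi> N \<longleftrightarrow>
     (\<forall>v\<in>games N. \<forall>i\<in>N. \<forall>S\<subseteq>N - {i}. \<forall>T\<subseteq>N - {i}.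
        \<Phi> N (v, T \<union> {i}) i - \<Phi> N (v, S \<union> {i}) i = - (\<Phi> N (v, T) i - \<Phi> N (v, S) i))"

definition admissible_alloc :: "'u set \<Rightarrow> 'u alloc \<Rightarrow> bool" where
  "admissible_alloc U \<Phi> \<longleftrightarrow>
     \<Phi> \<in> alloc_maps U \<and>
     (\<forall>N\<in>Fpow U.
        efficiency \<Phi> N \<and> linearity \<Phi> N \<and> symmetry \<Phi> N \<and> null_player \<Phi> N \<and> reflection \<Phi> N \<and>
        (\<forall>v\<in>games N. \<forall>i\<in>N. \<Phi> N (v, {}) i = 0))"


section \<open>Existence of the random coalition process\<close>

text \<open>
  The hypothesis \<^const>\<open>random_coalition_process\<close> is satisfiable for every nonempty finite player
  set: toggle the membership of players drawn independently and uniformly from \<open>N\<close>.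
\<close>

definition toggle_path :: "(nat \<Rightarrow> 'u) \<Rightarrow> nat \<Rightarrow> 'u set" where
  "toggle_path \<omega> t = rec_nat {} (\<lambda>k S. sym_diff S {\<omega> k}) t"

lemma toggle_path_simps:
  "toggle_path \<omega> 0 = {}" "toggle_path \<omega> (Suc t) = sym_diff (toggle_path \<omega> t) {\<omega> t}"
  by (simp_all add: toggle_path_def)

lemma toggle_path_subset: "(\<And>k. \<omega> k \<in> N) \<Longrightarrow> toggle_path \<omega> t \<subseteq> N"
  by (induction t) (auto simp: toggle_path_simps)

lemma toggle_path_eq_iff:
  "(\<forall>k\<le>t. toggle_path \<omega> k = toggle_path c k) \<longleftrightarrow> (\<forall>k<t. \<omega> k = c k)"
proof (induction t)
  case (Suc t)
  have "sym_diff A {x} = sym_diff A {y} \<longleftrightarrow> x = y" for A :: "'a set" and x y by blast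
  then have "(\<forall>k\<le>Suc t. toggle_path \<omega> k = toggle_path c k) \<longleftrightarrow>
      (\<forall>k\<le>t. toggle_path \<omega> k = toggle_path c k) \<and> \<omega> t = c t"
    by (simp add: le_Suc_eq all_conj_distrib imp_disjL) (metis order_refl toggle_path_simps(2))
  then show ?case using Suc.IH by (auto simp: less_Suc_eq)
qed (simp add: toggle_path_simps)

lemma edges_iff_sym_diff:
  assumes "S \<subseteq> N"
  shows "(S, T) \<in> edges N \<longleftrightarrow> (\<exists>i\<in>N. T = sym_diff S {i})"
proof
  assume "(S, T) \<in> edges N"
  then show "\<exists>i\<in>N. T = sym_diff S {i}"
    unfolding edges_def forward_edges_def reverse_edges_def by fastforce
next
  assume "\<exists>i\<in>N. T = sym_diff S {i}"
  then obtain i where i: "i \<in> N" "T = sym_diff S {i}" by blast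
  show "(S, T) \<in> edges N"
  proof (cases "i \<in> S")
    case True
    then have "S = T \<union> {i}" "T \<subseteq> N - {i}" using i assms by auto
    then have "(S, T) \<in> reverse_edges N" using i(1) unfolding reverse_edges_def by blast
    then show ?thesis by (simp add: edges_def)
  next
    case False
    then have "T = S \<union> {i}" "S \<subseteq> N - {i}" using i assms by auto
    then have "(S, T) \<in> forward_edges N" using i(1) unfolding forward_edges_def by blast
    then show ?thesis by (simp add: edges_def)
  qed
qed

lemma random_coalition_process_exists:
  fixes N :: "'u set"
  assumes "finite N" "N \<noteq> {}"
  shows "\<exists>(M :: (nat \<Rightarrow> 'u) measure) X. random_coalition_process M N X"
proof -
  define K where "K = uniform_count_measure N"
  define M where "M = PiM (UNIV :: nat set) (\<lambda>_. K)"
  define X where "X = (\<lambda>t (\<omega> :: nat \<Rightarrow> 'u). toggle_path \<omega> t)"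
  interpret K: prob_space K
    unfolding K_def using assms by (rule prob_space_uniform_count_measure)
  interpret P: product_prob_space "\<lambda>_ :: nat. K" UNIV
    by unfold_locales
  have sp: "space M = {\<omega>. \<forall>k. \<omega> k \<in> N}"
    by (auto simp: M_def space_PiM K_def space_uniform_count_measure)
  have K1: "measure K {x} = 1 / card N" if "x \<in> N" for x
    using that assms
    by (simp add: K_def measure_def emeasure_uniform_count_measure)
  have cyl: "{\<omega>\<in>space M. \<forall>k<t. \<omega> k = c k} = prod_emb UNIV (\<lambda>_. K) {..<t} (PiE {..<t} (\<lambda>k. {c k}))"
    for t and c :: "nat \<Rightarrow> 'u"
    by (auto simp: prod_emb_def M_def space_PiM PiE_iff)
  have pcyl: "measure M {\<omega>\<in>space M. \<forall>k<t. \<omega> k = c k} = (1 / card N) ^ t" if "\<And>k. k < t \<Longrightarrow> c k \<in> N" for t c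
    unfolding cyl unfolding M_def using that
    by (subst P.measure_PiM_emb) (auto simp: K_def sets_uniform_count_measure K1[unfolded K_def])
  have coord: "(\<lambda>\<omega>. \<omega> t) \<in> M \<rightarrow>\<^sub>M count_space N" for t
    unfolding M_def K_def
    using measurable_component_singleton[of t UNIV "\<lambda>_. uniform_count_measure N"]
    by (simp cong: measurable_cong_sets add: sets_uniform_count_measure_count_space)
  have meas: "X t \<in> M \<rightarrow>\<^sub>M count_space (Pow N)" for t
  proof (induction t)
    case 0
    then show ?case by (simp add: X_def toggle_path_simps)
  next
    case (Suc t)
    have "(\<lambda>\<omega>. (X t \<omega>, \<omega> t)) \<in> M \<rightarrow>\<^sub>M count_space (Pow N) \<Otimes>\<^sub>M count_space N"
      using Suc coord by (rule measurable_Pair)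
    also have "count_space (Pow N) \<Otimes>\<^sub>M count_space N = count_space (Pow N \<times> N)"
      using assms by (simp add: pair_measure_count_space)
    finally have 1: "(\<lambda>\<omega>. (X t \<omega>, \<omega> t)) \<in> M \<rightarrow>\<^sub>M count_space (Pow N \<times> N)" .
    have 2: "(\<lambda>(S, x). sym_diff S {x}) \<in> count_space (Pow N \<times> N) \<rightarrow>\<^sub>M count_space (Pow N)"
      by auto
    from measurable_compose[OF 1 2] show ?case by (simp add: X_def toggle_path_simps)
  qed
  have "\<P>(\<omega> in M. X (Suc t) \<omega> = T \<bar> \<forall>k\<le>t. X k \<omega> = s k) = trans_prob N (s t) T"
    if pos: "\<P>(\<omega> in M. \<forall>k\<le>t. X k \<omega> = s k) > 0" for t s T
  proof -
    from pos have "{\<omega>\<in>space M. \<forall>k\<le>t. X k \<omega> = s k} \<noteq> {}" by (metis less_irrefl measure_empty)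
    then obtain c where c: "c \<in> space M" "\<And>k. k \<le> t \<Longrightarrow> s k = toggle_path c k" by (auto simp: X_def)
    have cN: "c k \<in> N" for k using c(1) sp by auto
    have ev: "(\<forall>k\<le>t. X k \<omega> = s k) \<longleftrightarrow> (\<forall>k<t. \<omega> k = c k)" for \<omega>
      unfolding toggle_path_eq_iff[symmetric] by (simp add: c(2) X_def)
    have st: "s t \<subseteq> N" using c(2)[of t] toggle_path_subset[of c N t] cN by simp
    have p1: "\<P>(\<omega> in M. \<forall>k\<le>t. X k \<omega> = s k) = (1 / card N) ^ t"
      unfolding ev using pcyl[of t c] cN by simp
    have ev': "{\<omega>\<in>space M. X (Suc t) \<omega> = T \<and> (\<forall>k\<le>t. X k \<omega> = s k)} =
        {\<omega>\<in>space M. T = sym_diff (s t) {\<omega> t} \<and> (\<forall>k<t. \<omega> k = c k)}"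
      using ev by (auto simp: X_def toggle_path_simps)
    have "\<P>(\<omega> in M. X (Suc t) \<omega> = T \<and> (\<forall>k\<le>t. X k \<omega> = s k)) = (1 / card N) ^ t * trans_prob N (s t) T"
    proof (cases "(s t, T) \<in> edges N")
      case True
      then obtain j where j: "j \<in> N" "T = sym_diff (s t) {j}" using edges_iff_sym_diff[OF st] by blast
      have "T = sym_diff (s t) {x} \<longleftrightarrow> x = j" for x using j(2) by blast
      then have "{\<omega>\<in>space M. T = sym_diff (s t) {\<omega> t} \<and> (\<forall>k<t. \<omega> k = c k)} =
          {\<omega>\<in>space M. \<forall>k<Suc t. \<omega> k = (c(t := j)) k}"
        by (auto simp: less_Suc_eq)
      then show ?thesis unfolding ev' using pcyl[of "Suc t" "c(t := j)"] cN j(1) True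
        by (simp add: trans_prob_def)
    next
      case False
      then have "{\<omega>\<in>space M. T = sym_diff (s t) {\<omega> t} \<and> (\<forall>k<t. \<omega> k = c k)} = {}"
        using edges_iff_sym_diff[OF st] sp by auto
      note empty = this
      show ?thesis unfolding ev' empty using False by (simp add: trans_prob_def)
    qed
    then show ?thesis unfolding cond_prob_def p1 using assms by simp
  qed
  moreover have "prob_space M" unfolding M_def by (rule P.prob_space_axioms)
  moreover have "AE \<omega> in M. X 0 \<omega> = {}" by (simp add: X_def toggle_path_simps)
  ultimately have "random_coalition_process M N X"
    unfolding random_coalition_process_def using meas by blast
  then show ?thesis by blast
qed

end

theory Submission
  imports Defs
begin

text \<open>
  Harmonic analysis on the hypercube \<open>Pow N\<close> gives the admissible allocation in closed form. Expand
  a game in the Walsh functions \<open>S \<mapsto> (- 1) ^ card (A \<inter> S)\<close>, subtract the value at the empty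
  coalition, and let the members of each \<open>A\<close> share its term equally. The five properties can be read
  off the coefficients (\<open>walsh_alloc_admissible\<close>): equal division within \<open>A\<close> gives efficiency and
  symmetry, toggling \<open>i\<close> negates the Walsh functions with \<open>i \<in> A\<close>, which is reflection, and a null
  player only meets coefficients that are zero.

  Uniqueness is by induction on the player set. By linearity it is enough to treat the games given by
  a single Walsh function. If \<open>A \<noteq> N\<close>, there is a null player, and the induction hypothesis applies
  without this player. If \<open>A = N\<close>, the game is symmetric in all players, and efficiency, symmetry and
  reflection determine the allocation by a recursion on the size of the coalition with a single free
  constant, which the value at \<open>N\<close> fixes (\<open>symmetric_share_zero\<close>).

  For the path integral, Walsh functions diagonalise the graph Laplacian, and the allocation of \<open>i\<close>
  turns out to be the solution, zero at the empty coalition, of the Poisson equation whose right-hand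
  side is the divergence of the partial differential (\<open>walsh_share_poisson\<close>). The partial
  differential is thus the gradient of the allocation plus a divergence-free flow. Along a path from
  \<open>{}\<close> to \<open>T\<close> the gradient telescopes to the value of the allocation at \<open>T\<close>. A divergence-free flow
  has mean zero in the next step, given any history, so the expectation of its stopped sum vanishes
  (\<open>path_sum_expectation\<close>). Interchanging expectation and sum requires that the first visit to \<open>T\<close>
  has finite mean; this follows from a Lyapunov function of the distance to \<open>T\<close> (\<open>survival_summable\<close>).
\<close>

section \<open>Walsh functions on the lattice of coalitions\<close>

definition toggle :: "'u \<Rightarrow> 'u set \<Rightarrow> 'u set" where
  "toggle i S = sym_diff S {i}"

text \<open>
  The characters of the group \<open>(\<int>/2)\<^sup>N\<close>, with coalitions as group elements and \<^const>\<open>toggle\<close> as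
  translation by a generator. They are orthogonal, hence a basis of the functions on \<open>Pow N\<close>.
\<close>

definition walsh :: "'u set \<Rightarrow> 'u set \<Rightarrow> real" where
  "walsh A S = (- 1) ^ card (A \<inter> S)"

definition walsh_coeff :: "'u set \<Rightarrow> ('u set \<Rightarrow> real) \<Rightarrow> 'u set \<Rightarrow> real" where
  "walsh_coeff N v A = (\<Sum>S\<in>Pow N. v S * walsh A S) / 2 ^ card N"

lemma in_toggle_iff: "j \<in> toggle i S \<longleftrightarrow> (j \<in> S) \<noteq> (j = i)"
  by (auto simp: toggle_def)

lemma toggle_toggle [simp]: "toggle i (toggle i S) = S"
  by (auto simp: in_toggle_iff)

lemma toggle_subset_iff: "i \<in> N \<Longrightarrow> toggle i S \<subseteq> N \<longleftrightarrow> S \<subseteq> N"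
  by (auto simp: toggle_def)

lemma toggle_notin: "i \<notin> S \<Longrightarrow> toggle i S = insert i S"
  by (auto simp: toggle_def)

lemma sum_toggle:
  assumes "i \<in> N"
  shows "(\<Sum>S\<in>Pow N. f (toggle i S)) = (\<Sum>S\<in>Pow N. f S)"
  by (rule sum.reindex_bij_witness[of _ "toggle i" "toggle i"])
     (use assms in \<open>auto simp: toggle_subset_iff\<close>)

lemma walsh_commute: "walsh A S = walsh S A"
  by (simp add: walsh_def Int_commute)

lemma walsh_empty [simp]: "walsh A {} = 1"
  by (simp add: walsh_def)

lemma walsh_toggle:
  assumes "finite A"
  shows "walsh A (toggle i S) = (if i \<in> A then - walsh A S else walsh A S)"
proof (cases "i \<in> A")
  case True
  show ?thesis
  proof (cases "i \<in> S")
    case iS: True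
    have "A \<inter> S = insert i (A \<inter> toggle i S)" using True iS by (auto simp: in_toggle_iff)
    moreover have "i \<notin> A \<inter> toggle i S" using iS by (auto simp: in_toggle_iff)
    ultimately show ?thesis using assms True by (simp add: walsh_def)
  next
    case iS: False
    have "A \<inter> toggle i S = insert i (A \<inter> S)" using True iS by (auto simp: in_toggle_iff)
    then show ?thesis using assms True iS by (simp add: walsh_def)
  qed
next
  case False
  then have "A \<inter> toggle i S = A \<inter> S" by (auto simp: in_toggle_iff)
  then show ?thesis using False by (simp add: walsh_def)
qed

lemma walsh_insert:
  assumes "finite A" "i \<notin> S"
  shows "walsh A (insert i S) = (if i \<in> A then - walsh A S else walsh A S)"
  using walsh_toggle[OF assms(1), of i S] by (simp add: toggle_notin assms(2))

text \<open>
  A player on which \<open>S\<close> and \<open>S'\<close> differ gives a bijection \<^term>\<open>toggle i\<close> of the index set that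
  reverses the sign of every summand.
\<close>

lemma walsh_orthogonal:
  assumes "finite N" "S \<subseteq> N" "S' \<subseteq> N"
  shows "(\<Sum>A\<in>Pow N. walsh A S * walsh A S') = (if S = S' then 2 ^ card N else 0)"
proof (cases "S = S'")
  case True
  have "walsh A S * walsh A S = 1" for A
    by (simp add: walsh_def flip: power_mult_distrib)
  then show ?thesis using True assms by (simp add: card_Pow)
next
  case False
  then obtain i where i: "i \<in> N" "(i \<in> S) \<noteq> (i \<in> S')" using assms by blast
  have fin: "finite S" "finite S'" using assms finite_subset by auto
  let ?f = "\<lambda>A. walsh S A * walsh S' A"
  have "sum ?f (Pow N) = (\<Sum>A\<in>Pow N. ?f (toggle i A))" by (rule sum_toggle[OF i(1), symmetric])
  also have "\<dots> = - sum ?f (Pow N)"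
    using i(2) by (auto simp: walsh_toggle fin sum_negf)
  finally show ?thesis using False by (simp add: walsh_commute[of _ S] walsh_commute[of _ S'])
qed

lemma walsh_inversion:
  assumes "finite N" "S \<subseteq> N"
  shows "(\<Sum>A\<in>Pow N. walsh_coeff N v A * walsh A S) = v S"
proof -
  have "(\<Sum>A\<in>Pow N. walsh_coeff N v A * walsh A S) =
      (\<Sum>A\<in>Pow N. \<Sum>S'\<in>Pow N. v S' * (walsh A S' * walsh A S)) / 2 ^ card N"
    by (simp add: walsh_coeff_def sum_divide_distrib sum_distrib_right mult.assoc)
  also have "(\<Sum>A\<in>Pow N. \<Sum>S'\<in>Pow N. v S' * (walsh A S' * walsh A S)) =
      (\<Sum>S'\<in>Pow N. v S' * (\<Sum>A\<in>Pow N. walsh A S' * walsh A S))"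
    by (subst sum.swap) (simp add: sum_distrib_left)
  also have "\<dots> = (\<Sum>S'\<in>Pow N. if S' = S then v S * 2 ^ card N else 0)"
    using assms by (intro sum.cong) (auto simp: walsh_orthogonal)
  also have "\<dots> = v S * 2 ^ card N" using assms by (simp add: sum.delta)
  finally show ?thesis by simp
qed

section \<open>The Walsh allocation and its properties\<close>

text \<open>
  On a single character \<^term>\<open>walsh A\<close>, normalised to vanish at the empty coalition, the worth is
  shared equally by the members of \<open>A\<close>, in every coalition; the general case is the linear
  extension.
\<close>

definition walsh_share :: "'u set \<Rightarrow> ('u set \<Rightarrow> real) \<Rightarrow> 'u \<Rightarrow> 'u set \<Rightarrow> real" where
  "walsh_share N v i S =
     (\<Sum>A | A \<subseteq> N \<and> i \<in> A. walsh_coeff N v A / card A * (walsh A S - 1))"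

definition walsh_alloc :: "'u set \<Rightarrow> 'u alloc" where
  "walsh_alloc U =
     (\<lambda>N\<in>Fpow U. \<lambda>(v, S)\<in>games N \<times> Pow N. \<lambda>i\<in>N. walsh_share N v i S)"

lemma walsh_alloc_eq:
  assumes "N \<in> Fpow U" "v \<in> games N" "S \<subseteq> N" "i \<in> N"
  shows "walsh_alloc U N (v, S) i = walsh_share N v i S"
  using assms by (simp add: walsh_alloc_def)

lemma walsh_alloc_in_alloc_maps: "walsh_alloc U \<in> alloc_maps U"
  unfolding walsh_alloc_def alloc_maps_def by (simp add: restrict_PiE_iff split_beta)

lemma walsh_share_empty: "walsh_share N v i {} = 0"
  by (simp add: walsh_share_def)

lemma walsh_share_sum:
  assumes "finite N" "S \<subseteq> N"
  shows "(\<Sum>i\<in>N. walsh_share N v i S) = v S - v {}"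
proof -
  let ?g = "\<lambda>A. walsh_coeff N v A * (walsh A S - 1)"
  have "(\<Sum>i\<in>N. walsh_share N v i S) =
      (\<Sum>i\<in>N. \<Sum>A\<in>Pow N. if i \<in> A then ?g A / card A else 0)"
    unfolding walsh_share_def using assms
    by (intro sum.cong refl sum.mono_neutral_cong_left) auto
  also have "\<dots> = (\<Sum>A\<in>Pow N. \<Sum>i\<in>N. if i \<in> A then ?g A / card A else 0)"
    by (rule sum.swap)
  also have "\<dots> = (\<Sum>A\<in>Pow N. ?g A)"
  proof (rule sum.cong[OF refl])
    fix A assume A: "A \<in> Pow N"
    have "(\<Sum>i\<in>N. if i \<in> A then ?g A / card A else 0) = (\<Sum>i\<in>A. ?g A / card A)"
      using A assms by (intro sum.mono_neutral_cong_right) auto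
    also have "\<dots> = ?g A"
      using A assms finite_subset[of A N] by (cases "A = {}") (auto simp: walsh_def)
    finally show "(\<Sum>i\<in>N. if i \<in> A then ?g A / card A else 0) = ?g A" .
  qed
  also have "\<dots> = (\<Sum>A\<in>Pow N. walsh_coeff N v A * walsh A S)
      - (\<Sum>A\<in>Pow N. walsh_coeff N v A * walsh A {})"
    by (simp add: algebra_simps sum_subtractf)
  also have "\<dots> = v S - v {}" using assms by (simp only: walsh_inversion empty_subsetI)
  finally show ?thesis .
qed

lemma walsh_share_linear:
  "walsh_share N (lin_comb N a v a' v') i S = a * walsh_share N v i S + a' * walsh_share N v' i S"
proof -
  have "walsh_coeff N (lin_comb N a v a' v') A = a * walsh_coeff N v A + a' * walsh_coeff N v' A" for A
    by (simp add: walsh_coeff_def lin_comb_def sum_distrib_left algebra_simps sum.distrib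
        add_divide_distrib)
  then show ?thesis
    by (simp add: walsh_share_def sum_distrib_left algebra_simps sum.distrib add_divide_distrib)
qed

lemma switch_eq_image: "switch i j S = Transposition.transpose i j ` S"
  by (auto simp: switch_def Transposition.transpose_def image_iff)

lemma switch_switch [simp]: "switch i j (switch i j S) = S"
  by (auto simp: switch_def)

lemma switch_subset_iff: "i \<in> N \<Longrightarrow> j \<in> N \<Longrightarrow> switch i j S \<subseteq> N \<longleftrightarrow> S \<subseteq> N"
  by (auto simp: switch_def)

lemma card_switch [simp]: "card (switch i j S) = card S"
  unfolding switch_eq_image by (rule card_image) simp

lemma walsh_switch: "walsh A (switch i j S) = walsh (switch i j A) S"
proof -
  have "switch i j (A \<inter> switch i j S) = switch i j A \<inter> S"
    by (auto simp: switch_def)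
  then have "card (A \<inter> switch i j S) = card (switch i j A \<inter> S)"
    by (metis card_switch)
  then show ?thesis by (simp add: walsh_def)
qed

lemma walsh_share_switch:
  assumes "i \<in> N" "j \<in> N"
  shows "walsh_share N (switch_game N i j v) i (switch i j S) = walsh_share N v j S"
proof -
  have coeff: "walsh_coeff N (switch_game N i j v) A = walsh_coeff N v (switch i j A)" for A
  proof -
    have "(\<Sum>S\<in>Pow N. switch_game N i j v S * walsh A S) =
        (\<Sum>S\<in>Pow N. v S * walsh (switch i j A) S)"
      by (rule sum.reindex_bij_witness[of _ "switch i j" "switch i j"])
         (use assms in \<open>auto simp: switch_subset_iff switch_game_def walsh_switch\<close>)
    then show ?thesis by (simp add: walsh_coeff_def)
  qed
  have mem: "i \<in> switch i j A \<longleftrightarrow> j \<in> A" "j \<in> switch i j A \<longleftrightarrow> i \<in> A" for A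
    by (auto simp: switch_def)
  show ?thesis unfolding walsh_share_def
    by (rule sum.reindex_bij_witness[of _ "switch i j" "switch i j"])
       (use assms in \<open>auto simp: switch_subset_iff coeff mem walsh_switch\<close>)
qed

text \<open>
  This turns the hypothesis of the null-player property from a condition on edges into an
  invariance under \<^const>\<open>toggle\<close>, the form in which it meets the Walsh functions.
\<close>

lemma partial_diff_zero_iff:
  assumes "i \<in> N"
  shows "(\<forall>(S, T)\<in>edges N. partial_diff i v S T = 0) \<longleftrightarrow> (\<forall>S\<subseteq>N. v (toggle i S) = v S)"
proof
  assume H: "\<forall>(S, T)\<in>edges N. partial_diff i v S T = 0"
  have *: "v (insert i S) = v S" if "S \<subseteq> N" "i \<notin> S" for S
  proof -
    have "(S, S \<union> {i}) \<in> edges N"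
      using that assms unfolding edges_def forward_edges_def by blast
    then have "partial_diff i v S (S \<union> {i}) = 0" using H by fast
    then show ?thesis using that by (simp add: partial_diff_def)
  qed
  show "\<forall>S\<subseteq>N. v (toggle i S) = v S"
  proof (intro allI impI)
    fix S assume S: "S \<subseteq> N"
    show "v (toggle i S) = v S"
    proof (cases "i \<in> S")
      case False then show ?thesis using * S by (simp add: toggle_notin)
    next
      case True
      then have "toggle i S = S - {i}" by (auto simp: toggle_def)
      moreover have "v (insert i (S - {i})) = v (S - {i})" using S by (intro *) auto
      ultimately show ?thesis using True by (simp add: insert_absorb)
    qed
  qed
next
  assume H: "\<forall>S\<subseteq>N. v (toggle i S) = v S"
  show "\<forall>(S, T)\<in>edges N. partial_diff i v S T = 0"
  proof clarify
    fix S T assume e: "(S, T) \<in> edges N"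
    then have ST: "S \<subseteq> N" "T \<subseteq> N"
      unfolding edges_def forward_edges_def reverse_edges_def by auto
    have "v (insert i R) = v R" if "R \<subseteq> N" "i \<notin> R" for R
      using H that by (metis toggle_notin)
    then show "partial_diff i v S T = 0" using ST by (simp add: partial_diff_def)
  qed
qed

text \<open>
  Toggling a null player shows that the coefficients at all \<open>A\<close> containing this player vanish. For
  the other \<open>A\<close> the sum defining the coefficient has two equal halves, so that its normalisation
  turns it into the coefficient for the smaller player set.
\<close>

lemma walsh_share_null:
  assumes fin: "finite N" and i: "i \<in> N" and null: "\<forall>S\<subseteq>N. v (toggle i S) = v S"
    and j: "j \<in> N - {i}" and S: "S \<subseteq> N - {i}"
  shows "walsh_share N v j S = walsh_share (N - {i}) (remove_player N i v) j S"
    and "walsh_share N v j (S \<union> {i}) = walsh_share N v j S"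
proof -
  have coeff0: "walsh_coeff N v A = 0" if A: "A \<subseteq> N" "i \<in> A" for A
  proof -
    have "(\<Sum>S\<in>Pow N. v S * walsh A S) = (\<Sum>S\<in>Pow N. v (toggle i S) * walsh A (toggle i S))"
      by (rule sum_toggle[OF i, symmetric])
    also have "\<dots> = - (\<Sum>S\<in>Pow N. v S * walsh A S)"
      using A fin finite_subset[of A N] by (auto simp: walsh_toggle null sum_negf)
    finally show ?thesis by (simp add: walsh_coeff_def)
  qed
  have coeff: "walsh_coeff N v A = walsh_coeff (N - {i}) (remove_player N i v) A"
    if A: "A \<subseteq> N - {i}" for A
  proof -
    have N: "N = insert i (N - {i})" using i by auto
    have finA: "finite A" using A fin finite_subset by blast
    have "(\<Sum>S\<in>Pow N. v S * walsh A S) =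
        (\<Sum>S\<in>Pow (N - {i}) \<union> insert i ` Pow (N - {i}). v S * walsh A S)"
      by (subst N, subst Pow_insert) simp
    also have "\<dots> = (\<Sum>S\<in>Pow (N - {i}). v S * walsh A S) + (\<Sum>S\<in>insert i ` Pow (N - {i}). v S * walsh A S)"
      using fin by (intro sum.union_disjoint) auto
    also have "(\<Sum>S\<in>insert i ` Pow (N - {i}). v S * walsh A S) = (\<Sum>S\<in>Pow (N - {i}). v (insert i S) * walsh A (insert i S))"
      by (subst sum.reindex) (auto simp: inj_on_def)
    also have "\<dots> = (\<Sum>S\<in>Pow (N - {i}). v S * walsh A S)"
    proof (rule sum.cong[OF refl])
      fix S assume S: "S \<in> Pow (N - {i})"
      then have "i \<notin> S" "S \<subseteq> N" by auto
      then show "v (insert i S) * walsh A (insert i S) = v S * walsh A S"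
        using null[rule_format, of S] A by (auto simp: toggle_notin walsh_insert[OF finA])
    qed
    finally have "(\<Sum>S\<in>Pow N. v S * walsh A S) = 2 * (\<Sum>S\<in>Pow (N - {i}). v S * walsh A S)" by simp
    moreover have "card N = Suc (card (N - {i}))" by (rule card_Suc_Diff1[OF fin i, symmetric])
    ultimately show ?thesis by (simp add: walsh_coeff_def remove_player_def)
  qed
  show "walsh_share N v j S = walsh_share (N - {i}) (remove_player N i v) j S"
    unfolding walsh_share_def
    by (rule sum.mono_neutral_cong_right) (use fin coeff0 coeff in auto)
  have "walsh_coeff N v A / card A * (walsh A (S \<union> {i}) - 1) = walsh_coeff N v A / card A * (walsh A S - 1)"
    if "A \<subseteq> N" for A
  proof (cases "i \<in> A")
    case True
    then show ?thesis using coeff0[OF that] by simp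
  next
    case False
    moreover have "i \<notin> S" using S by auto
    ultimately show ?thesis using finite_subset[OF that fin] by (simp add: walsh_insert)
  qed
  then show "walsh_share N v j (S \<union> {i}) = walsh_share N v j S"
    unfolding walsh_share_def by (intro sum.cong refl) auto
qed

text \<open>
  Every \<open>A\<close> that contributes contains \<open>i\<close>, and for these \<open>A\<close> adding \<open>i\<close> negates \<^term>\<open>walsh A\<close>.
  The sum of the shares at \<open>R\<close> and at \<^term>\<open>R \<union> {i}\<close> is therefore the same for all \<open>R\<close> without
  \<open>i\<close>.
\<close>

lemma walsh_share_reflection:
  assumes "finite N" "i \<notin> S" "i \<notin> T"
  shows "walsh_share N v i (T \<union> {i}) - walsh_share N v i (S \<union> {i}) =
    - (walsh_share N v i T - walsh_share N v i S)"
proof -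
  have *: "walsh_share N v i (R \<union> {i}) + walsh_share N v i R =
      (\<Sum>A | A \<subseteq> N \<and> i \<in> A. - 2 * (walsh_coeff N v A / card A))" if "i \<notin> R" for R
    unfolding walsh_share_def sum.distrib[symmetric]
    by (intro sum.cong refl)
       (use that assms in \<open>auto simp: walsh_insert finite_subset algebra_simps add_divide_distrib diff_divide_distrib\<close>)
  show ?thesis using *[OF assms(2)] *[OF assms(3)] by simp
qed

lemma walsh_alloc_admissible: "admissible_alloc U (walsh_alloc U)"
  unfolding admissible_alloc_def
proof (intro conjI ballI)
  show "walsh_alloc U \<in> alloc_maps U" by (rule walsh_alloc_in_alloc_maps)
  fix N assume N: "N \<in> Fpow U"
  then have fin: "finite N" by (simp add: Fpow_def)
  note eq = walsh_alloc_eq[OF N]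
  show "efficiency (walsh_alloc U) N" unfolding efficiency_def
  proof (intro ballI allI impI)
    fix v S assume v: "v \<in> games N" and S: "S \<subseteq> N"
    then have "v {} = 0" by (simp add: games_def)
    then show "v S = (\<Sum>i\<in>N. walsh_alloc U N (v, S) i)"
      using walsh_share_sum[OF fin S, of v] v S by (simp add: eq)
  qed
  show "linearity (walsh_alloc U) N" unfolding linearity_def
  proof (intro ballI allI impI)
    fix v v' a a' S i
    assume v: "v \<in> games N" "v' \<in> games N" "S \<subseteq> N" "i \<in> N"
    then have "lin_comb N a v a' v' \<in> games N" by (simp add: games_def lin_comb_def)
    then show "walsh_alloc U N (lin_comb N a v a' v', S) i =
        a * walsh_alloc U N (v, S) i + a' * walsh_alloc U N (v', S) i"
      using v by (simp add: eq walsh_share_linear)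
  qed
  show "symmetry (walsh_alloc U) N" unfolding symmetry_def
  proof (intro ballI allI impI)
    fix v i j S assume v: "v \<in> games N" "i \<in> N" "j \<in> N" "S \<subseteq> N"
    then have "switch_game N i j v \<in> games N" by (simp add: games_def switch_game_def switch_def)
    then show "walsh_alloc U N (switch_game N i j v, switch i j S) i = walsh_alloc U N (v, S) j"
      using v by (simp add: eq walsh_share_switch switch_subset_iff)
  qed
  show "null_player (walsh_alloc U) N" unfolding null_player_def
  proof (intro ballI allI impI)
    fix v i j S
    assume v: "v \<in> games N" and i: "i \<in> N" and "\<forall>(S, T)\<in>edges N. partial_diff i v S T = 0"
      and j: "j \<in> N - {i}" and S: "S \<subseteq> N - {i}"
    then have null: "\<forall>S\<subseteq>N. v (toggle i S) = v S" by (simp add: partial_diff_zero_iff)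
    have N': "N - {i} \<in> Fpow U" using N by (auto simp: Fpow_def)
    have v': "remove_player N i v \<in> games (N - {i})"
      using v by (simp add: games_def remove_player_def)
    show "walsh_alloc U N (v, S \<union> {i}) j = walsh_alloc U N (v, S) j \<and>
        walsh_alloc U N (v, S) j = walsh_alloc U (N - {i}) (remove_player N i v, S) j"
      using walsh_share_null[OF fin i null j S] walsh_alloc_eq[OF N' v' S j] v i j S
      by (auto simp: eq subset_iff)
  qed
  show "reflection (walsh_alloc U) N" unfolding reflection_def
  proof (intro ballI allI impI)
    fix v i S T assume v: "v \<in> games N" "i \<in> N" "S \<subseteq> N - {i}" "T \<subseteq> N - {i}"
    then have notin: "i \<notin> S" "i \<notin> T"
      and sub: "S \<subseteq> N" "T \<subseteq> N" "S \<union> {i} \<subseteq> N" "T \<union> {i} \<subseteq> N" by auto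
    show "walsh_alloc U N (v, T \<union> {i}) i - walsh_alloc U N (v, S \<union> {i}) i =
        - (walsh_alloc U N (v, T) i - walsh_alloc U N (v, S) i)"
      using walsh_share_reflection[OF fin notin, of v] by (simp only: eq[OF v(1) _ v(2)] sub)
  qed
  show "walsh_alloc U N (v, {}) i = 0" if "v \<in> games N" "i \<in> N" for v i
    using that by (simp add: eq walsh_share_empty)
qed

section \<open>Uniqueness of the admissible allocation\<close>

text \<open>
  Think of \<open>d\<close> as the difference of two allocations of one symmetric game. By symmetry \<open>d i S\<close> takes
  one value on the members of \<open>S\<close> and one on the others, and efficiency makes the second a nonpositive
  multiple of the first. Reflection then computes the value inside \<^term>\<open>insert j S\<close> from the value
  inside \<open>S\<close>: it is \<open>c\<close> plus a nonnegative multiple of it, where \<open>c\<close> is the common value at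
  singletons. Along a chain from the empty coalition up to \<open>N\<close> the values thus move away from zero
  in the direction of \<open>c\<close>; but efficiency forces the value inside \<open>N\<close> to be zero, so \<open>c = 0\<close>, and
  then all values vanish.
\<close>

lemma symmetric_share_zero:
  fixes d :: "'u \<Rightarrow> 'u set \<Rightarrow> real"
  assumes fin: "finite N"
    and eff: "\<And>S. S \<subseteq> N \<Longrightarrow> (\<Sum>i\<in>N. d i S) = 0"
    and sym: "\<And>S i j. S \<subseteq> N \<Longrightarrow> i \<in> N \<Longrightarrow> j \<in> N \<Longrightarrow> d i (switch i j S) = d j S"
    and mirror: "\<And>S i. S \<subseteq> N - {i} \<Longrightarrow> i \<in> N \<Longrightarrow> d i (insert i S) - d i {i} = - d i S"
    and S: "S \<subseteq> N" and i: "i \<in> N"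
  shows "d i S = 0"
proof -
  define c where "c = d i {i}"
  have c: "d j {j} = c" if "j \<in> N" for j
    using sym[of "{j}" i j] that i by (cases "i = j") (auto simp: c_def switch_def insert_Diff_if)
  have same: "d j S = d k S" if "S \<subseteq> N" "j \<in> N" "k \<in> N" "j \<in> S \<longleftrightarrow> k \<in> S" for j k S
    using sym[of S j k] that by (auto simp: switch_def)
  \<comment> \<open>For \<open>S = {}\<close> or \<open>S = N\<close> one of the two players need not exist; its coefficient is then zero.\<close>
  have balance: "real (card S) * d j S + real (card (N - S)) * d k S = 0"
    if "S \<subseteq> N" "S \<noteq> {} \<Longrightarrow> j \<in> S" "S \<noteq> N \<Longrightarrow> k \<in> N - S" for S j k
  proof -
    have "(\<Sum>l\<in>N. d l S) = (\<Sum>l\<in>S. d l S) + (\<Sum>l\<in>N - S. d l S)"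
      using that fin by (metis add.commute sum.subset_diff)
    also have "(\<Sum>l\<in>S. d l S) = (\<Sum>l\<in>S. d j S)" using that by (intro sum.cong refl same) auto
    also have "(\<Sum>l\<in>N - S. d l S) = (\<Sum>l\<in>N - S. d k S)" using that by (intro sum.cong refl same) auto
    finally show ?thesis using eff[OF that(1)] by simp
  qed
  have step: "d j (insert j S) = c + real (card S) / real (card (N - S)) * d k S"
    if S: "S \<subseteq> N" "j \<in> N - S" "S \<noteq> {} \<Longrightarrow> k \<in> S" for S j k
  proof -
    have "card (N - S) > 0" using that fin by (auto simp: card_gt_0_iff)
    then have "d j S = - (real (card S) / real (card (N - S)) * d k S)"
      using balance[of S k j] that by (simp add: field_simps)
    moreover have "d j (insert j S) - d j {j} = - d j S" using that by (intro mirror) auto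
    ultimately show ?thesis using c[of j] that by simp
  qed
  \<comment> \<open>Multiplying by \<open>c\<close> covers both signs of \<open>c\<close> at once.\<close>
  have grow: "j \<in> S \<Longrightarrow> c * c \<le> c * d j S" if "finite S" "S \<subseteq> N" for S j
    using that
  proof (induction S arbitrary: j rule: finite_induct)
    case (insert k S)
    show ?case
    proof (cases "S = {}")
      case True then show ?thesis using c[of k] insert by simp
    next
      case False
      then obtain l where l: "l \<in> S" by blast
      have "d j (insert k S) = d k (insert k S)" using insert by (intro same) auto
      also have "\<dots> = c + real (card S) / real (card (N - S)) * d l S"
        using insert l by (intro step) auto
      finally have "c * d j (insert k S) = c * c + real (card S) / real (card (N - S)) * (c * d l S)"
        by (simp add: algebra_simps)
      moreover have "0 \<le> c * d l S"
        using order_trans[OF zero_le_square[of c] insert.IH[OF l]] insert.prems(2) by simp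
      ultimately show ?thesis by (simp add: divide_nonneg_nonneg)
    qed
  qed simp
  have "c * d i N = 0" using balance[of N i i] i fin by (auto simp: card_eq_0_iff)
  then have "c * c \<le> 0" using grow[OF fin order_refl i] by linarith
  then have c0: "c = 0" by (metis mult_eq_0_iff order_antisym zero_le_square)
  have ins: "j \<in> S \<Longrightarrow> d j S = 0" if "finite S" "S \<subseteq> N" for S j
    using that
  proof (induction S arbitrary: j rule: finite_induct)
    case (insert k S)
    show ?case
    proof (cases "S = {}")
      case True then show ?thesis using c[of k] insert c0 by simp
    next
      case False
      then obtain l where l: "l \<in> S" by blast
      have "d j (insert k S) = d k (insert k S)" using insert by (intro same) auto
      also have "\<dots> = c + real (card S) / real (card (N - S)) * d l S"
        using insert l by (intro step) auto
      finally show ?thesis using insert.IH[OF l] insert.prems c0 by simp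
    qed
  qed simp
  show ?thesis
  proof (cases "i \<in> S")
    case True then show ?thesis using ins S fin finite_subset by blast
  next
    case False
    have "d i (insert i S) = 0" using S i fin finite_subset[OF S fin] by (intro ins) auto
    moreover have "d i (insert i S) - d i {i} = - d i S" using S i False by (intro mirror) auto
    ultimately show ?thesis using c[of i] c0 i by simp
  qed
qed

definition walsh_game :: "'u set \<Rightarrow> 'u set \<Rightarrow> 'u set \<Rightarrow> real" where
  "walsh_game N A = (\<lambda>S\<in>Pow N. walsh A S - 1)"

lemma walsh_game_in_games: "walsh_game N A \<in> games N"
  by (simp add: walsh_game_def games_def)

lemma linearityD:
  assumes "linearity \<Phi> N" "v \<in> games N" "v' \<in> games N" "S \<subseteq> N" "i \<in> N"
  shows "\<Phi> N (lin_comb N a v a' v', S) i = a * \<Phi> N (v, S) i + a' * \<Phi> N (v', S) i"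
  using assms by (simp add: linearity_def)

lemma symmetryD:
  assumes "symmetry \<Phi> N" "v \<in> games N" "i \<in> N" "j \<in> N" "S \<subseteq> N"
  shows "\<Phi> N (switch_game N i j v, switch i j S) i = \<Phi> N (v, S) j"
  using assms by (simp add: symmetry_def)

lemma reflectionD:
  assumes "reflection \<Phi> N" "v \<in> games N" "i \<in> N" "S \<subseteq> N - {i}" "T \<subseteq> N - {i}"
  shows "\<Phi> N (v, T \<union> {i}) i - \<Phi> N (v, S \<union> {i}) i = - (\<Phi> N (v, T) i - \<Phi> N (v, S) i)"
  using assms(1)[unfolded reflection_def, rule_format, OF assms(2-5)] .

lemma null_playerD:
  assumes "null_player \<Phi> N" "v \<in> games N" "i \<in> N" "\<forall>(S, T)\<in>edges N. partial_diff i v S T = 0"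
    and "j \<in> N - {i}" "S \<subseteq> N - {i}"
  shows "\<Phi> N (v, S \<union> {i}) j = \<Phi> N (v, S) j \<and>
    \<Phi> N (v, S) j = \<Phi> (N - {i}) (remove_player N i v, S) j"
  using assms(1)[unfolded null_player_def, rule_format, OF assms(2,3) _ assms(5,6)] assms(4)
  by blast

text \<open>
  By linearity it suffices to compare the two allocations on the games \<^term>\<open>walsh_game N A\<close>. If
  \<open>A \<noteq> N\<close>, every player outside \<open>A\<close> is null, which passes the question to a smaller player set, and
  efficiency recovers the share of the null player itself. The one remaining game, for \<open>A = N\<close>, is
  symmetric in all players and is covered by \<open>symmetric_share_zero\<close>.
\<close>

lemma admissible_alloc_unique_on:
  assumes adm: "admissible_alloc U \<Phi>" "admissible_alloc U \<Psi>" and "N \<in> Fpow U"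
    and "v \<in> games N" "S \<subseteq> N" "i \<in> N"
  shows "\<Phi> N (v, S) i = \<Psi> N (v, S) i"
proof -
  have "finite N" using assms(3) by (simp add: Fpow_def)
  then show ?thesis using assms(3-)
  proof (induction N arbitrary: v S i rule: finite_psubset_induct)
    case (psubset N)
    note fin = psubset.hyps and N = psubset.prems(1)
    note props = adm[unfolded admissible_alloc_def, THEN conjunct2, THEN bspec, OF N]
    have effs: "(\<Sum>i\<in>N. \<Phi> N (v, S) i) = v S" "(\<Sum>i\<in>N. \<Psi> N (v, S) i) = v S"
      if "v \<in> games N" "S \<subseteq> N" for v S
      using props that unfolding efficiency_def by simp_all
    have basis: "\<Phi> N (walsh_game N A, S) i = \<Psi> N (walsh_game N A, S) i"
      if A: "A \<subseteq> N" and S: "S \<subseteq> N" and i: "i \<in> N" for A S i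
    proof (cases "A = N")
      case False
      then obtain k where k: "k \<in> N" "k \<notin> A" using A by blast
      let ?g = "walsh_game N A"
      have g: "?g \<in> games N" by (rule walsh_game_in_games)
      have "?g (toggle k S) = ?g S" if "S \<subseteq> N" for S
        using that k A fin finite_subset[OF A fin]
        by (simp add: walsh_game_def toggle_subset_iff walsh_toggle)
      then have null: "\<forall>(S, T)\<in>edges N. partial_diff k ?g S T = 0"
        by (simp add: partial_diff_zero_iff k)
      have N': "N - {k} \<in> Fpow U" using N by (auto simp: Fpow_def)
      have g': "remove_player N k ?g \<in> games (N - {k})"
        using g by (simp add: games_def remove_player_def)
      have np: "\<Phi> N (?g, R \<union> {k}) j = \<Phi> N (?g, R) j \<and>
            \<Phi> N (?g, R) j = \<Phi> (N - {k}) (remove_player N k ?g, R) j"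
          "\<Psi> N (?g, R \<union> {k}) j = \<Psi> N (?g, R) j \<and>
            \<Psi> N (?g, R) j = \<Psi> (N - {k}) (remove_player N k ?g, R) j"
        if "R \<subseteq> N - {k}" "j \<in> N - {k}" for R j
        using props null_playerD[OF _ g k(1) null that(2,1)] by blast+
      have off: "\<Phi> N (?g, S) j = \<Psi> N (?g, S) j" if j: "j \<in> N - {k}" for j
      proof -
        have R: "S - {k} \<subseteq> N - {k}" using S by auto
        have "N - {k} \<subset> N" using k(1) by blast
        note IH = psubset.IH[OF this N' g' R j]
        have "S = S - {k} \<or> S = (S - {k}) \<union> {k}" by auto
        then show ?thesis
        proof
          assume "S = S - {k}"
          then show ?thesis using np[OF R j] IH by simp
        next
          assume "S = (S - {k}) \<union> {k}"
          then show ?thesis using np[OF R j] IH by simp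
        qed
      qed
      show ?thesis
      proof (cases "i = k")
        case False then show ?thesis using off i by simp
      next
        case True
        have "(\<Sum>j\<in>N. \<Phi> N (?g, S) j) = (\<Sum>j\<in>N. \<Psi> N (?g, S) j)" using effs[OF g S] by simp
        moreover have "(\<Sum>j\<in>N - {k}. \<Phi> N (?g, S) j) = (\<Sum>j\<in>N - {k}. \<Psi> N (?g, S) j)"
          by (rule sum.cong) (auto simp: off)
        ultimately show ?thesis using True fin k(1) by (simp add: sum.remove)
      qed
    next
      case True
      let ?g = "walsh_game N N"
      have g: "?g \<in> games N" by (rule walsh_game_in_games)
      have sw: "switch_game N i j ?g = ?g" if "i \<in> N" "j \<in> N" for i j
      proof
        have "switch i j N = N" using that by (auto simp: switch_def)
        then show "switch_game N i j ?g S = ?g S" for S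
          using that by (auto simp: switch_game_def walsh_game_def switch_subset_iff walsh_switch)
      qed
      define d where "d = (\<lambda>i S. \<Phi> N (?g, S) i - \<Psi> N (?g, S) i)"
      have "d i S = 0"
      proof (rule symmetric_share_zero[OF fin _ _ _ S i])
        show "(\<Sum>i\<in>N. d i S) = 0" if "S \<subseteq> N" for S
          using effs[OF g that] by (simp add: d_def sum_subtractf)
        show "d i (switch i j S) = d j S" if "S \<subseteq> N" "i \<in> N" "j \<in> N" for S i j
        proof -
          have "\<Phi> N (switch_game N i j ?g, switch i j S) i = \<Phi> N (?g, S) j"
               "\<Psi> N (switch_game N i j ?g, switch i j S) i = \<Psi> N (?g, S) j"
            using symmetryD[OF _ g that(2,3,1)] props by blast+
          then show ?thesis by (simp add: d_def sw that)
        qed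
        show "d i (insert i S) - d i {i} = - d i S" if "S \<subseteq> N - {i}" "i \<in> N" for S i
        proof -
          have "\<Phi> N (?g, S \<union> {i}) i - \<Phi> N (?g, {} \<union> {i}) i = - (\<Phi> N (?g, S) i - \<Phi> N (?g, {}) i)"
               "\<Psi> N (?g, S \<union> {i}) i - \<Psi> N (?g, {} \<union> {i}) i = - (\<Psi> N (?g, S) i - \<Psi> N (?g, {}) i)"
            using reflectionD[OF _ g that(2) empty_subsetI that(1)] props by blast+
          moreover have "\<Phi> N (?g, {}) i = 0" "\<Psi> N (?g, {}) i = 0" using props that(2) g by blast+
          ultimately show ?thesis by (simp add: d_def)
        qed
      qed
      then show ?thesis using True by (simp add: d_def)
    qed
    have lins: "\<Phi> N (lin_comb N a u a' u', S) i = a * \<Phi> N (u, S) i + a' * \<Phi> N (u', S) i"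
        "\<Psi> N (lin_comb N a u a' u', S) i = a * \<Psi> N (u, S) i + a' * \<Psi> N (u', S) i"
      if "u \<in> games N" "u' \<in> games N" for u u' a a'
      using linearityD[OF _ that psubset.prems(3,4)] props by blast+
    define span where "span = (\<lambda>F. \<lambda>S\<in>Pow N. \<Sum>A\<in>F. walsh_coeff N v A * walsh_game N A S)"
    have span_games: "span F \<in> games N" for F
      by (simp add: span_def games_def walsh_game_def)
    have "F \<subseteq> Pow N \<Longrightarrow> \<Phi> N (span F, S) i = \<Psi> N (span F, S) i" if "finite F" for F
      using that
    proof (induction F rule: finite_induct)
      case empty
      have "span {} = lin_comb N 0 v 0 v" by (simp add: span_def lin_comb_def)
      then show ?case using lins[of v v 0 0] psubset.prems(2) by simp
    next
      case (insert A F)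
      have "span (insert A F) = lin_comb N (walsh_coeff N v A) (walsh_game N A) 1 (span F)"
        using insert.hyps by (auto simp: span_def lin_comb_def)
      then show ?case
        using insert lins[OF walsh_game_in_games span_games] basis psubset.prems by simp
    qed
    moreover have "span (Pow N) = v"
    proof
      fix R
      show "span (Pow N) R = v R"
      proof (cases "R \<subseteq> N")
        case True
        have "span (Pow N) R = (\<Sum>A\<in>Pow N. walsh_coeff N v A * walsh A R)
            - (\<Sum>A\<in>Pow N. walsh_coeff N v A * walsh A {})"
          using True by (simp add: span_def walsh_game_def algebra_simps sum_subtractf)
        also have "\<dots> = v R - v {}" using True fin by (simp only: walsh_inversion empty_subsetI)
        finally show ?thesis using psubset.prems(2) by (simp add: games_def)
      next
        case False
        then show ?thesis using psubset.prems(2)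
          by (auto simp: span_def games_def PiE_def extensional_def)
      qed
    qed
    ultimately show ?case using fin by (metis finite_Pow_iff order_refl)
  qed
qed

lemma admissible_alloc_unique:
  assumes "admissible_alloc U \<Phi>" "admissible_alloc U \<Psi>"
  shows "\<Phi> = \<Psi>"
proof -
  have mem: "\<Phi> \<in> alloc_maps U" "\<Psi> \<in> alloc_maps U"
    using assms by (simp_all add: admissible_alloc_def)
  have memN: "\<Phi> N \<in> games N \<times> Pow N \<rightarrow>\<^sub>E (N \<rightarrow>\<^sub>E UNIV)" "\<Psi> N \<in> games N \<times> Pow N \<rightarrow>\<^sub>E (N \<rightarrow>\<^sub>E UNIV)"
    if "N \<in> Fpow U" for N
    using mem[unfolded alloc_maps_def, THEN PiE_mem, OF that] by simp_all
  show ?thesis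
  proof (rule PiE_ext[OF mem[unfolded alloc_maps_def]])
    fix N assume N: "N \<in> Fpow U"
    show "\<Phi> N = \<Psi> N"
    proof (rule PiE_ext[OF memN[OF N]])
      fix p assume p: "p \<in> games N \<times> Pow N"
      show "\<Phi> N p = \<Psi> N p"
      proof (rule PiE_ext)
        show "\<Phi> N p \<in> N \<rightarrow>\<^sub>E UNIV" "\<Psi> N p \<in> N \<rightarrow>\<^sub>E UNIV" using memN[OF N, THEN PiE_mem, OF p] by (cases p; simp)+
        show "\<Phi> N p i = \<Psi> N p i" if "i \<in> N" for i
          using admissible_alloc_unique_on[OF assms N _ _ that, of "fst p" "snd p"] p by auto
      qed
    qed
  qed
qed

section \<open>The Poisson equation of the Walsh allocation\<close>

text \<open>
  The functions \<^term>\<open>walsh A\<close> are eigenfunctions of the graph Laplacian, with eigenvalue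
  \<open>2 * card A\<close>, and of the difference in direction \<open>i\<close>, with eigenvalue \<open>2\<close> if \<open>i \<in> A\<close> and \<open>0\<close>
  otherwise. The quotient of the two is the weight \<open>1 / card A\<close> of the Walsh allocation: the share of
  \<open>i\<close> is the potential whose gradient has the same divergence as the partial differential of \<open>v\<close>.
\<close>

lemma walsh_share_poisson:
  assumes fin: "finite N" and S: "S \<subseteq> N" and i: "i \<in> N"
  shows "(\<Sum>j\<in>N. walsh_share N v i (toggle j S) - walsh_share N v i S) = v (toggle i S) - v S"
proof -
  let ?c = "walsh_coeff N v" and ?P = "{A. A \<subseteq> N \<and> i \<in> A}"
  have finP: "finite A" if "A \<subseteq> N" for A using that fin finite_subset by blast
  have "(\<Sum>j\<in>N. walsh_share N v i (toggle j S) - walsh_share N v i S) =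
      (\<Sum>A\<in>?P. \<Sum>j\<in>N. ?c A / card A * (walsh A (toggle j S) - walsh A S))"
    unfolding walsh_share_def sum_subtractf[symmetric]
    by (subst sum.swap) (simp add: algebra_simps diff_divide_distrib)
  also have "\<dots> = (\<Sum>A\<in>?P. - 2 * ?c A * walsh A S)"
  proof (rule sum.cong[OF refl])
    fix A assume A: "A \<in> ?P"
    have "(\<Sum>j\<in>N. ?c A / card A * (walsh A (toggle j S) - walsh A S)) =
        (\<Sum>j\<in>A. ?c A / card A * (- 2 * walsh A S))"
      using A fin finP by (intro sum.mono_neutral_cong_right) (auto simp: walsh_toggle)
    also have "\<dots> = - 2 * ?c A * walsh A S"
      using A finP[of A] by (auto simp: card_eq_0_iff)
    finally show "(\<Sum>j\<in>N. ?c A / card A * (walsh A (toggle j S) - walsh A S)) = - 2 * ?c A * walsh A S" .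
  qed
  also have "\<dots> = (\<Sum>A\<in>Pow N. ?c A * walsh A (toggle i S) - ?c A * walsh A S)"
    using fin finP by (intro sum.mono_neutral_cong_left) (auto simp: walsh_toggle)
  also have "\<dots> = v (toggle i S) - v S"
    using S i fin by (simp add: sum_subtractf walsh_inversion toggle_subset_iff)
  finally show ?thesis .
qed

section \<open>Stopped sums along the random coalition process\<close>

lemma partial_diff_toggle:
  "partial_diff i v S (toggle j S) = (if j = i then v (toggle i S) - v S else 0)"
proof (cases "j = i")
  case True
  have "toggle i S = S - {i}" if "i \<in> S" using that by (auto simp: toggle_def)
  then show ?thesis using True
    by (cases "i \<in> S") (simp_all add: partial_diff_def toggle_notin insert_absorb)
next
  case False
  have "\<not> (i \<notin> S \<and> toggle j S = S \<union> {i})" "\<not> (i \<notin> toggle j S \<and> S = toggle j S \<union> {i})"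
    using False by (metis UnI2 in_toggle_iff singletonI)+
  then show ?thesis using False by (auto simp: partial_diff_def)
qed

lemma sum_trans_prob:
  assumes "finite N" "S \<subseteq> N"
  shows "(\<Sum>S'\<in>Pow N. trans_prob N S S' * g S') = (\<Sum>j\<in>N. g (toggle j S)) / card N"
proof -
  have inj: "inj_on (\<lambda>j. toggle j S) N"
    by (auto simp: inj_on_def toggle_def)
  have "(\<Sum>S'\<in>Pow N. trans_prob N S S' * g S') = (\<Sum>S'\<in>(\<lambda>j. toggle j S) ` N. g S' / card N)"
    using assms
    by (intro sum.mono_neutral_cong_right)
       (auto simp: trans_prob_def edges_iff_sym_diff in_toggle_iff simp flip: toggle_def)
  also have "\<dots> = (\<Sum>j\<in>N. g (toggle j S)) / card N"
    by (simp add: sum.reindex[OF inj] sum_divide_distrib)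
  finally show ?thesis .
qed

text \<open>
  A Lyapunov function for the walk. Away from \<open>T\<close> there is at least one player whose toggling
  decreases the distance to \<open>T\<close>. The base \<open>r\<close> is so small that this one decrease outweighs an
  increase by all the other players, whatever the distance: \<open>card N * r - 1 = - 1 / 2\<close>.
\<close>

lemma distance_drift:
  fixes T :: "'u set"
  assumes fin: "finite N" and sub: "S \<subseteq> N" "T \<subseteq> N" and "S \<noteq> T"
  defines "r \<equiv> 1 / (2 * real (card N))"
  defines "h \<equiv> \<lambda>S. 1 - r ^ card (sym_diff S T)"
  shows "(\<Sum>j\<in>N. h (toggle j S) - h S) \<le> - (r ^ card N / 2)"
proof -
  define D where "D = sym_diff S T"
  have DN: "D \<subseteq> N" and finD: "finite D" using sub fin by (auto simp: D_def dest: finite_subset)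
  obtain k where k: "k \<in> D" using \<open>S \<noteq> T\<close> by (auto simp: D_def)
  have kN: "k \<in> N" using k DN by auto
  then have n: "card N > 0" using fin by (auto simp: card_gt_0_iff)
  have r: "0 \<le> r" "r \<le> 1" "real (card N) * r = 1 / 2" using n by (auto simp: r_def)
  have dist: "sym_diff (toggle j S) T = toggle j D" for j
    by (auto simp: toggle_def D_def)
  have "toggle k D = D - {k}" using k by (auto simp: toggle_def)
  moreover obtain m where m: "card D = Suc m" using k finD by (cases "card D") auto
  ultimately have card_k: "card (toggle k D) = m" using k finD by simp
  have "card D \<le> card N" using DN fin by (rule card_mono[rotated])
  then have mn: "m \<le> card N" using m by simp
  have "(\<Sum>j\<in>N. h (toggle j S) - h S) =
      (h (toggle k S) - h S) + (\<Sum>j\<in>N - {k}. h (toggle j S) - h S)"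
    using fin kN by (rule sum.remove)
  also have "h (toggle k S) - h S = r ^ Suc m - r ^ m"
    unfolding h_def dist card_k using m by (simp add: D_def)
  also have "(\<Sum>j\<in>N - {k}. h (toggle j S) - h S) \<le> (\<Sum>j\<in>N - {k}. r ^ Suc m)"
  proof (rule sum_mono)
    fix j
    have "h (toggle j S) - h S = r ^ Suc m - r ^ card (toggle j D)"
      unfolding h_def dist using m by (simp add: D_def)
    then show "h (toggle j S) - h S \<le> r ^ Suc m" using r(1) by simp
  qed
  also have "\<dots> = (real (card N) - 1) * r ^ Suc m" using fin kN n by (simp add: of_nat_diff)
  also have "r ^ Suc m - r ^ m + (real (card N) - 1) * r ^ Suc m = (real (card N) * r - 1) * r ^ m"
    by (simp add: algebra_simps)
  also have "\<dots> = - (r ^ m / 2)" by (simp add: r(3))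
  also have "\<dots> \<le> - (r ^ card N / 2)" using power_decreasing[OF mn r(1,2)] by simp
  finally show ?thesis by simp
qed

locale coalition_process = prob_space M for M :: "'a measure" +
  fixes N :: "'u set" and X :: "nat \<Rightarrow> 'a \<Rightarrow> 'u set"
  assumes process: "random_coalition_process M N X"
    and finite_N: "finite N" and N_nonempty: "N \<noteq> {}"
begin

text \<open>
  Time \<open>0\<close> is left out because the visit that stops the walk occurs at a time \<open>t \<ge> 1\<close>; for \<open>T = {}\<close>
  the walk starts at \<open>T\<close> and is stopped only when it returns.
\<close>

definition survives :: "'u set \<Rightarrow> nat \<Rightarrow> 'a \<Rightarrow> bool" where
  "survives T t \<omega> \<longleftrightarrow> (\<forall>k\<in>{1..t}. X k \<omega> \<noteq> T)"

definition increment :: "('u set \<Rightarrow> 'u set \<Rightarrow> real) \<Rightarrow> 'u set \<Rightarrow> nat \<Rightarrow> 'a \<Rightarrow> real" where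
  "increment F T t \<omega> = (if survives T t \<omega> then F (X t \<omega>) (X (Suc t) \<omega>) else 0)"

definition stopped_sum :: "('u set \<Rightarrow> 'u set \<Rightarrow> real) \<Rightarrow> 'u set \<Rightarrow> 'a \<Rightarrow> real" where
  "stopped_sum F T \<omega> = (\<Sum>t = 1..first_visit X T \<omega>. F (X (t - 1) \<omega>) (X t \<omega>))"

lemma X_measurable [measurable]: "X t \<in> M \<rightarrow>\<^sub>M count_space (Pow N)"
  using process by (simp add: random_coalition_process_def)

lemma X_subset: "\<omega> \<in> space M \<Longrightarrow> X t \<omega> \<subseteq> N"
  using measurable_space[OF X_measurable] by fastforce

lemma X_zero: "AE \<omega> in M. X 0 \<omega> = {}"
  using process by (simp add: random_coalition_process_def)

lemma X_eq_measurable [measurable]: "Measurable.pred M (\<lambda>\<omega>. X t \<omega> = S)"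
  using measurable_compose[OF X_measurable, of "\<lambda>R. R = S" "count_space UNIV"] by simp

lemma survives_measurable [measurable]: "Measurable.pred M (survives T t)"
  unfolding survives_def by measurable

lemma pair_measurable [measurable]:
  fixes F :: "'u set \<Rightarrow> 'u set \<Rightarrow> real"
  shows "(\<lambda>\<omega>. F (X s \<omega>) (X t \<omega>)) \<in> borel_measurable M"
proof -
  have "(\<lambda>\<omega>. (X s \<omega>, X t \<omega>)) \<in> M \<rightarrow>\<^sub>M count_space (Pow N) \<Otimes>\<^sub>M count_space (Pow N)"
    by measurable
  also have "count_space (Pow N) \<Otimes>\<^sub>M count_space (Pow N) = count_space (Pow N \<times> Pow N)"
    using finite_N by (simp add: pair_measure_count_space)
  finally show ?thesis
    using measurable_compose[of "\<lambda>\<omega>. (X s \<omega>, X t \<omega>)" M _ "case_prod F" borel] by simp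
qed

lemma increment_measurable [measurable]: "increment F T t \<in> borel_measurable M"
  unfolding increment_def by measurable

text \<open>
  The bound keeps the indicator of survival, so that expected increments are dominated by the
  survival probabilities, which are summable.
\<close>

lemma increment_bound:
  "\<exists>B. \<forall>T t. \<forall>\<omega>\<in>space M. \<bar>increment F T t \<omega>\<bar> \<le> B * indicator {\<omega>. survives T t \<omega>} \<omega>"
proof -
  define B where "B = (\<Sum>p\<in>Pow N \<times> Pow N. \<bar>case_prod F p\<bar>)"
  have "\<bar>F S S'\<bar> \<le> B" if "S \<subseteq> N" "S' \<subseteq> N" for S S'
    using member_le_sum[of "(S, S')" "Pow N \<times> Pow N" "\<lambda>p. \<bar>case_prod F p\<bar>"] that finite_N
    by (simp add: B_def)
  then show ?thesis
    by (intro exI[of _ B]) (simp add: increment_def X_subset)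
qed

lemma increment_integrable: "integrable M (increment F T t)"
proof -
  obtain B where B: "\<And>T t \<omega>. \<omega> \<in> space M \<Longrightarrow> \<bar>increment F T t \<omega>\<bar> \<le> B * indicator {\<omega>. survives T t \<omega>} \<omega>"
    using increment_bound[of F] by blast
  show ?thesis
    by (rule integrable_const_bound[where B = "\<bar>B\<bar>"])
       (auto intro!: AE_I2 order_trans[OF B] simp: indicator_def)
qed

lemma integrable_scaled_indicator: "A \<in> events \<Longrightarrow> integrable M (\<lambda>\<omega>. c * indicator A \<omega> :: real)"
  by (simp add: integrable_indicator_iff emeasure_eq_measure)

lemma expectation_simple:
  assumes "\<And>i. i \<in> I \<Longrightarrow> A i \<in> events"
  shows "expectation (\<lambda>\<omega>. \<Sum>i\<in>I. c i * indicator (A i) \<omega>) = (\<Sum>i\<in>I. c i * prob (A i))"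
proof -
  have "expectation (\<lambda>\<omega>. \<Sum>i\<in>I. c i * indicator (A i) \<omega>) =
      (\<Sum>i\<in>I. expectation (\<lambda>\<omega>. c i * indicator (A i) \<omega>))"
    by (intro Bochner_Integration.integral_sum integrable_scaled_indicator assms)
  then show ?thesis using assms by simp
qed

text \<open>
  Histories of probability zero, about which the Markov property says nothing, satisfy the product
  form trivially.
\<close>

lemma markov_step:
  assumes "S' \<subseteq> N"
  shows "prob {\<omega>\<in>space M. X (Suc t) \<omega> = S' \<and> (\<forall>k\<le>t. X k \<omega> = s k)} =
    prob {\<omega>\<in>space M. \<forall>k\<le>t. X k \<omega> = s k} * trans_prob N (s t) S'"
proof (cases "prob {\<omega>\<in>space M. \<forall>k\<le>t. X k \<omega> = s k} > 0")
  case True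
  then have "\<P>(\<omega> in M. X (Suc t) \<omega> = S' \<bar> \<forall>k\<le>t. X k \<omega> = s k) = trans_prob N (s t) S'"
    using process assms by (simp add: random_coalition_process_def)
  then show ?thesis using True by (simp add: cond_prob_def field_simps)
next
  case False
  have "prob {\<omega>\<in>space M. X (Suc t) \<omega> = S' \<and> (\<forall>k\<le>t. X k \<omega> = s k)} \<le>
      prob {\<omega>\<in>space M. \<forall>k\<le>t. X k \<omega> = s k}"
    by (rule finite_measure_mono) auto
  then show ?thesis using False by (simp add: not_less measure_le_0_iff)
qed

text \<open>
  Survival up to time \<open>t\<close> and \<open>X t\<close> are determined by the history up to time \<open>t\<close>, so decomposing
  over the finitely many surviving histories replaces the next step by its average over the
  neighbours of \<open>X t\<close>.
\<close>

lemma expectation_increment: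
  "expectation (increment F T t) =
    expectation (\<lambda>\<omega>. if survives T t \<omega> then (\<Sum>j\<in>N. F (X t \<omega>) (toggle j (X t \<omega>))) / card N else 0)"
proof -
  define H where "H = {s \<in> {..t} \<rightarrow>\<^sub>E Pow N. \<forall>k\<in>{1..t}. s k \<noteq> T}"
  define E where "E = (\<lambda>s. {\<omega>\<in>space M. \<forall>k\<le>t. X k \<omega> = s k})"
  define E' where "E' = (\<lambda>s S'. {\<omega>\<in>space M. X (Suc t) \<omega> = S' \<and> (\<forall>k\<le>t. X k \<omega> = s k)})"
  have E_sets [measurable]: "E s \<in> events" for s unfolding E_def by measurable
  have E'_sets [measurable]: "E' s S' \<in> events" for s S' unfolding E'_def by measurable
  have finH: "finite H" unfolding H_def using finite_N by (simp add: finite_PiE)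
  have split: "(\<Sum>s\<in>H. g (s t) * indicator (E s) \<omega>) = (if survives T t \<omega> then g (X t \<omega>) else 0)"
    if \<omega>: "\<omega> \<in> space M" for \<omega> and g :: "'u set \<Rightarrow> real"
  proof -
    define s0 where "s0 = restrict (\<lambda>k. X k \<omega>) {..t}"
    have s0H: "s0 \<in> H \<longleftrightarrow> survives T t \<omega>"
      using X_subset[OF \<omega>] by (auto simp: H_def s0_def survives_def)
    have "\<omega> \<in> E s \<longleftrightarrow> s = s0" if "s \<in> H" for s
    proof
      assume "\<omega> \<in> E s"
      then show "s = s0" using that
        by (intro extensionalityI[of _ "{..t}"]) (auto simp: H_def s0_def E_def PiE_def)
    qed (use \<omega> in \<open>auto simp: E_def s0_def\<close>)
    then have "(\<Sum>s\<in>H. g (s t) * indicator (E s) \<omega>) = (\<Sum>s\<in>H. if s = s0 then g (s t) else 0)"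
      by (intro sum.cong) (auto simp: indicator_def)
    also have "\<dots> = (if s0 \<in> H then g (s0 t) else 0)" using finH by simp
    finally show ?thesis by (simp add: s0H) (simp add: s0_def)
  qed
  have "increment F T t \<omega> = (\<Sum>s\<in>H. \<Sum>S'\<in>Pow N. F (s t) S' * indicator (E' s S') \<omega>)"
    if \<omega>: "\<omega> \<in> space M" for \<omega>
  proof -
    have "(\<Sum>S'\<in>Pow N. F (s t) S' * indicator (E' s S') \<omega>) =
        (\<Sum>S'\<in>Pow N. if S' = X (Suc t) \<omega> then F (s t) S' * indicator (E s) \<omega> else 0)" for s
      using \<omega> by (intro sum.cong) (auto simp: E_def E'_def indicator_def)
    then have "(\<Sum>s\<in>H. \<Sum>S'\<in>Pow N. F (s t) S' * indicator (E' s S') \<omega>) =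
        (\<Sum>s\<in>H. F (s t) (X (Suc t) \<omega>) * indicator (E s) \<omega>)"
      using finite_N X_subset[OF \<omega>] by simp
    then show ?thesis using split[OF \<omega>, of "\<lambda>S. F S (X (Suc t) \<omega>)"] by (simp add: increment_def)
  qed
  then have "expectation (increment F T t) =
      expectation (\<lambda>\<omega>. \<Sum>s\<in>H. \<Sum>S'\<in>Pow N. F (s t) S' * indicator (E' s S') \<omega>)"
    by (intro Bochner_Integration.integral_cong) auto
  also have "\<dots> = (\<Sum>s\<in>H. \<Sum>S'\<in>Pow N. F (s t) S' * prob (E' s S'))"
    using expectation_simple[of "H \<times> Pow N" "\<lambda>(s, S'). E' s S'" "\<lambda>(s, S'). F (s t) S'"]
    by (simp add: sum.cartesian_product split_beta E'_sets)
  also have "\<dots> = (\<Sum>s\<in>H. (\<Sum>S'\<in>Pow N. trans_prob N (s t) S' * F (s t) S') * prob (E s))"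
    unfolding sum_distrib_right
    by (intro sum.cong refl) (simp add: E_def E'_def markov_step)
  also have "\<dots> = (\<Sum>s\<in>H. (\<Sum>j\<in>N. F (s t) (toggle j (s t))) / card N * prob (E s))"
  proof (intro sum.cong refl)
    fix s assume "s \<in> H"
    then have "s t \<subseteq> N" by (auto simp: H_def)
    then show "(\<Sum>S'\<in>Pow N. trans_prob N (s t) S' * F (s t) S') * prob (E s) =
        (\<Sum>j\<in>N. F (s t) (toggle j (s t))) / card N * prob (E s)"
      by (simp add: sum_trans_prob finite_N)
  qed
  also have "\<dots> = expectation (\<lambda>\<omega>. \<Sum>s\<in>H. (\<Sum>j\<in>N. F (s t) (toggle j (s t))) / card N * indicator (E s) \<omega>)"
    by (rule expectation_simple[symmetric]) (rule E_sets)
  also have "\<dots> = expectation (\<lambda>\<omega>. if survives T t \<omega> then (\<Sum>j\<in>N. F (X t \<omega>) (toggle j (X t \<omega>))) / card N else 0)"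
    by (intro Bochner_Integration.integral_cong refl split)
  finally show ?thesis .
qed

text \<open>
  While the walk survives, the Lyapunov function loses at least \<open>\<epsilon>\<close> per step in expectation. As it
  takes values in \<open>[0, 1]\<close>, the survival probabilities from time \<open>1\<close> on have a sum of at most
  \<open>1 / \<epsilon>\<close>; in other words, the time of the first visit is integrable.
\<close>

lemma survival_summable:
  assumes T: "T \<subseteq> N"
  shows "summable (\<lambda>t. prob {\<omega>\<in>space M. survives T t \<omega>})"
proof -
  define q where "q = (\<lambda>t. prob {\<omega>\<in>space M. survives T t \<omega>})"
  define r where "r = 1 / (2 * real (card N))"
  define h where "h = (\<lambda>S. 1 - r ^ card (sym_diff S T))"
  define \<epsilon> where "\<epsilon> = r ^ card N / (2 * card N)"
  define H where "H = (\<lambda>t. expectation (increment (\<lambda>S S'. h S) T t))"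
  have n: "card N > 0" using finite_N N_nonempty by (simp add: card_gt_0_iff)
  have r: "0 < r" "r \<le> 1" using n by (auto simp: r_def)
  have eps: "\<epsilon> > 0" using r n by (simp add: \<epsilon>_def)
  have h01: "0 \<le> h S" "h S \<le> 1" for S using r by (auto simp: h_def power_le_one)
  have hT: "h T = 0" by (simp add: h_def)
  have H0: "0 \<le> H t" for t
    unfolding H_def by (intro Bochner_Integration.integral_nonneg) (simp add: increment_def h01)
  \<comment> \<open>At time \<open>0\<close> the walk may sit at \<open>T\<close>, where the drift is positive; hence \<open>t \<ge> 1\<close>.\<close>
  have step: "H (Suc t) \<le> H t - \<epsilon> * q t" if t: "t \<ge> 1" for t
  proof -
    \<comment> \<open>A walk that dies at time \<open>Suc t\<close> is at \<open>T\<close>, where \<open>h\<close> vanishes,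
       so its value there may be counted.\<close>
    have "increment (\<lambda>S S'. h S) T (Suc t) \<omega> - increment (\<lambda>S S'. h S) T t \<omega> =
        increment (\<lambda>S S'. h S' - h S) T t \<omega>" for \<omega>
      using hT by (auto simp: increment_def survives_def atLeastAtMostSuc_conv)
    then have "H (Suc t) - H t = expectation (increment (\<lambda>S S'. h S' - h S) T t)"
      unfolding H_def by (subst Bochner_Integration.integral_diff[symmetric])
        (simp_all add: increment_integrable)
    also have "\<dots> = expectation (\<lambda>\<omega>. if survives T t \<omega>
        then (\<Sum>j\<in>N. h (toggle j (X t \<omega>)) - h (X t \<omega>)) / card N else 0)"
      by (rule expectation_increment)
    also have "\<dots> \<le> expectation (\<lambda>\<omega>. - \<epsilon> * indicator {\<omega>\<in>space M. survives T t \<omega>} \<omega>)"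
    proof (rule integral_mono)
      have "(\<lambda>\<omega>. if survives T t \<omega> then (\<Sum>j\<in>N. h (toggle j (X t \<omega>)) - h (X t \<omega>)) / card N else 0) =
          increment (\<lambda>S S'. (\<Sum>j\<in>N. h (toggle j S) - h S) / card N) T t"
        by (simp add: increment_def fun_eq_iff)
      then show "integrable M (\<lambda>\<omega>. if survives T t \<omega> then (\<Sum>j\<in>N. h (toggle j (X t \<omega>)) - h (X t \<omega>)) / card N else 0)"
        by (simp add: increment_integrable)
      show "integrable M (\<lambda>\<omega>. - \<epsilon> * indicator {\<omega>\<in>space M. survives T t \<omega>} \<omega>)"
        by (rule integrable_scaled_indicator) measurable
      fix \<omega> assume \<omega>: "\<omega> \<in> space M"
      have "(\<Sum>j\<in>N. h (toggle j (X t \<omega>)) - h (X t \<omega>)) / card N \<le> - \<epsilon>" if "survives T t \<omega>"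
      proof -
        have "X t \<omega> \<noteq> T" using that t by (auto simp: survives_def)
        then have "(\<Sum>j\<in>N. h (toggle j (X t \<omega>)) - h (X t \<omega>)) \<le> - (r ^ card N / 2)"
          unfolding h_def r_def by (intro distance_drift finite_N X_subset[OF \<omega>] T)
        then have "(\<Sum>j\<in>N. h (toggle j (X t \<omega>)) - h (X t \<omega>)) / card N \<le> - (r ^ card N / 2) / card N"
          by (intro divide_right_mono) auto
        then show ?thesis by (simp add: \<epsilon>_def)
      qed
      then show "(if survives T t \<omega> then (\<Sum>j\<in>N. h (toggle j (X t \<omega>)) - h (X t \<omega>)) / card N else 0)
          \<le> - \<epsilon> * indicator {\<omega>\<in>space M. survives T t \<omega>} \<omega>"
        using \<omega> by simp
    qed
    also have "\<dots> = - \<epsilon> * q t" by (simp add: q_def)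
    finally show ?thesis by simp
  qed
  have tel: "\<epsilon> * (\<Sum>t<m. q (Suc t)) \<le> H 1 - H (Suc m)" for m
  proof (induction m)
    case (Suc m)
    then show ?case using step[of "Suc m"] by (simp add: algebra_simps)
  qed simp
  have "(\<Sum>t<m. q (Suc t)) \<le> H 1 / \<epsilon>" for m
    using tel[of m] H0[of "Suc m"] eps by (simp add: field_simps)
  then have "summable (\<lambda>t. q (Suc t))"
    by (intro summableI_nonneg_bounded) (simp_all add: q_def)
  then have "summable q" by (simp only: summable_Suc_iff)
  then show ?thesis by (simp add: q_def)
qed

lemma AE_visited:
  assumes "T \<subseteq> N"
  shows "AE \<omega> in M. \<exists>t\<ge>1. X t \<omega> = T"
proof -
  define A where "A = {\<omega>\<in>space M. \<forall>t. survives T t \<omega>}"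
  have A: "A \<in> events" unfolding A_def by measurable
  have "(\<lambda>t. prob {\<omega>\<in>space M. survives T t \<omega>}) \<longlonglongrightarrow> 0"
    by (rule summable_LIMSEQ_zero[OF survival_summable[OF assms]])
  moreover have "prob A \<le> prob {\<omega>\<in>space M. survives T t \<omega>}" for t
    unfolding A_def by (rule finite_measure_mono) auto
  ultimately have "prob A \<le> 0" by (intro LIMSEQ_le_const) auto
  then have "prob A = 0" by (simp add: measure_le_0_iff)
  then have "AE \<omega> in M. \<omega> \<notin> A" using A by (simp add: prob_eq_0)
  then show ?thesis by (rule AE_mp) (auto intro!: AE_I2 simp: A_def survives_def)
qed

lemma first_visit:
  assumes "\<exists>t\<ge>1. X t \<omega> = T"
  shows "1 \<le> first_visit X T \<omega>" "X (first_visit X T \<omega>) \<omega> = T"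
    and "survives T t \<omega> \<longleftrightarrow> t < first_visit X T \<omega>"
proof -
  let ?V = "{t. 1 \<le> t \<and> X t \<omega> = T}"
  have "first_visit X T \<omega> \<in> ?V"
    unfolding first_visit_def using assms by (intro Inf_nat_def1) auto
  then show *: "1 \<le> first_visit X T \<omega>" "X (first_visit X T \<omega>) \<omega> = T" by auto
  have "first_visit X T \<omega> \<le> k" if "1 \<le> k" "X k \<omega> = T" for k
    unfolding first_visit_def using that by (intro cInf_lower) auto
  then show "survives T t \<omega> \<longleftrightarrow> t < first_visit X T \<omega>"
    using * unfolding survives_def by (metis atLeastAtMost_iff le_trans not_le)
qed

lemma increment_sums:
  assumes "\<exists>t\<ge>1. X t \<omega> = T"
  shows "(\<lambda>t. increment F T t \<omega>) sums stopped_sum F T \<omega>"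
    and "summable (\<lambda>t. \<bar>increment F T t \<omega>\<bar>)"
proof -
  let ?\<tau> = "first_visit X T \<omega>"
  have zero: "increment F T t \<omega> = 0" if "t \<notin> {..<?\<tau>}" for t
    using that first_visit(3)[OF assms] by (simp add: increment_def)
  have "(\<lambda>t. increment F T t \<omega>) sums (\<Sum>t<?\<tau>. increment F T t \<omega>)"
    by (rule sums_finite) (simp_all add: zero)
  also have "(\<Sum>t<?\<tau>. increment F T t \<omega>) = (\<Sum>t<?\<tau>. F (X t \<omega>) (X (Suc t) \<omega>))"
    by (intro sum.cong) (simp_all add: increment_def first_visit(3)[OF assms])
  also have "\<dots> = stopped_sum F T \<omega>"
    by (simp add: stopped_sum_def sum.atLeast1_atMost_eq)
  finally show "(\<lambda>t. increment F T t \<omega>) sums stopped_sum F T \<omega>" .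
  show "summable (\<lambda>t. \<bar>increment F T t \<omega>\<bar>)"
    by (rule summable_finite[of "{..<?\<tau>}"]) (simp_all add: zero)
qed

text \<open>
  The number of summands is random; measurability follows by splitting over its countably many
  values.
\<close>

lemma stopped_sum_measurable [measurable]: "stopped_sum F T \<in> borel_measurable M"
proof -
  have "first_visit X T \<in> M \<rightarrow>\<^sub>M count_space UNIV"
    unfolding first_visit_def[abs_def] Inf_nat_def by simp
  then have "(\<lambda>\<omega>. (\<lambda>n \<omega>. \<Sum>t = 1..n. F (X (t - 1) \<omega>) (X t \<omega>)) (first_visit X T \<omega>) \<omega>) \<in> borel_measurable M"
    by (rule measurable_compose_countable[rotated]) measurable
  then show ?thesis by (simp add: stopped_sum_def[abs_def])
qed

text \<open>
  Exchanging the sum over time with the expectation is justified by the summability of the survival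
  probabilities.
\<close>

lemma stopped_sum_expectation:
  assumes T: "T \<subseteq> N"
  shows "integrable M (stopped_sum F T)"
    and "(\<lambda>t. expectation (increment F T t)) sums expectation (stopped_sum F T)"
proof -
  obtain B where B: "\<And>T t \<omega>. \<omega> \<in> space M \<Longrightarrow> \<bar>increment F T t \<omega>\<bar> \<le> B * indicator {\<omega>. survives T t \<omega>} \<omega>"
    using increment_bound[of F] by blast
  have bound: "norm (expectation (\<lambda>\<omega>. norm (increment F T t \<omega>))) \<le> B * prob {\<omega>\<in>space M. survives T t \<omega>}" for t
  proof -
    have ev: "{\<omega>\<in>space M. survives T t \<omega>} \<in> events" by measurable
    have "expectation (\<lambda>\<omega>. norm (increment F T t \<omega>)) \<le>
        expectation (\<lambda>\<omega>. B * indicator {\<omega>\<in>space M. survives T t \<omega>} \<omega>)"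
    proof (rule integral_mono)
      show "integrable M (\<lambda>\<omega>. norm (increment F T t \<omega>))" by (simp add: increment_integrable)
      show "integrable M (\<lambda>\<omega>. B * indicator {\<omega>\<in>space M. survives T t \<omega>} \<omega>)"
        by (rule integrable_scaled_indicator[OF ev])
      fix \<omega> assume "\<omega> \<in> space M"
      then show "norm (increment F T t \<omega>) \<le> B * indicator {\<omega>\<in>space M. survives T t \<omega>} \<omega>"
        using B[of \<omega> T t] by (simp add: indicator_def)
    qed
    then show ?thesis by simp
  qed
  have norms: "summable (\<lambda>t. expectation (\<lambda>\<omega>. norm (increment F T t \<omega>)))"
    by (rule summable_comparison_test'[OF summable_mult[OF survival_summable[OF T]], of 0])
       (rule bound)
  have AE_summable: "AE \<omega> in M. summable (\<lambda>t. norm (increment F T t \<omega>))"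
    using AE_visited[OF T] by eventually_elim (simp add: increment_sums(2))
  have AE_eq: "AE \<omega> in M. (\<Sum>t. increment F T t \<omega>) = stopped_sum F T \<omega>"
    using AE_visited[OF T] by eventually_elim (metis increment_sums(1) sums_unique)
  show "integrable M (stopped_sum F T)"
    by (rule integrable_cong_AE_imp[OF integrable_suminf[OF increment_integrable AE_summable norms]
          stopped_sum_measurable AE_eq])
  have "expectation (\<lambda>\<omega>. \<Sum>t. increment F T t \<omega>) = expectation (stopped_sum F T)"
    by (rule integral_cong_AE[OF _ stopped_sum_measurable AE_eq]) measurable
  then show "(\<lambda>t. expectation (increment F T t)) sums expectation (stopped_sum F T)"
    using sums_integral[OF increment_integrable AE_summable norms] by simp
qed

text \<open>
  The partial sums of a divergence-free flow form a martingale, and this is optional stopping for it: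
  averaged over the next step, every stopped increment is already zero.
\<close>

lemma divergence_free_expectation:
  assumes T: "T \<subseteq> N" and div: "\<And>S. S \<subseteq> N \<Longrightarrow> (\<Sum>j\<in>N. F S (toggle j S)) = 0"
  shows "expectation (stopped_sum F T) = 0"
proof -
  have "expectation (increment F T t) = 0" for t
  proof -
    have "expectation (increment F T t) = expectation (\<lambda>\<omega>. 0)"
      unfolding expectation_increment
      by (intro Bochner_Integration.integral_cong) (simp_all add: div X_subset)
    then show ?thesis by simp
  qed
  then show ?thesis using stopped_sum_expectation(2)[OF T, of F] sums_unique2[OF _ sums_zero] by simp
qed

lemma gradient_expectation:
  assumes T: "T \<subseteq> N"
  shows "expectation (stopped_sum (\<lambda>S S'. w S' - w S) T) = w T - w {}"
proof -
  have "AE \<omega> in M. stopped_sum (\<lambda>S S'. w S' - w S) T \<omega> = w T - w {}"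
    using X_zero AE_visited[OF T]
  proof eventually_elim
    case (elim \<omega>)
    have "stopped_sum (\<lambda>S S'. w S' - w S) T \<omega> =
        (\<Sum>t<first_visit X T \<omega>. w (X (Suc t) \<omega>) - w (X t \<omega>))"
      by (simp add: stopped_sum_def sum.atLeast1_atMost_eq)
    also have "\<dots> = w (X (first_visit X T \<omega>) \<omega>) - w (X 0 \<omega>)"
      by (rule sum_lessThan_telescope)
    finally show ?case using first_visit(2)[OF elim(2)] elim(1) by simp
  qed
  then have "expectation (stopped_sum (\<lambda>S S'. w S' - w S) T) = expectation (\<lambda>\<omega>. w T - w {})"
    using stopped_sum_expectation(1)[OF T] by (intro integral_cong_AE) auto
  then show ?thesis by (simp add: prob_space)
qed

text \<open>
  A potential \<open>w\<close> with the divergence of the partial differential splits the latter into the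
  gradient of \<open>w\<close>, whose path sum telescopes, and a divergence-free remainder, whose path sum has mean
  zero (a Hodge decomposition).
\<close>

lemma path_sum_expectation:
  assumes T: "T \<subseteq> N" and i: "i \<in> N"
    and poisson: "\<And>S. S \<subseteq> N \<Longrightarrow> (\<Sum>j\<in>N. w (toggle j S) - w S) = v (toggle i S) - v S"
  shows "integrable M (path_sum X i v T)" "expectation (path_sum X i v T) = w T - w {}"
proof -
  have eq: "path_sum X i v T = stopped_sum (partial_diff i v) T"
    by (simp add: path_sum_def stopped_sum_def fun_eq_iff)
  show "integrable M (path_sum X i v T)"
    unfolding eq by (rule stopped_sum_expectation(1)[OF T])
  define g where "g = (\<lambda>S S'. partial_diff i v S S' - (w S' - w S))"
  have "(\<Sum>j\<in>N. g S (toggle j S)) = 0" if "S \<subseteq> N" for S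
  proof -
    have "(\<Sum>j\<in>N. partial_diff i v S (toggle j S)) = v (toggle i S) - v S"
      using i finite_N by (simp add: partial_diff_toggle)
    then show ?thesis using poisson[OF that] by (simp add: g_def sum_subtractf)
  qed
  then have g: "expectation (stopped_sum g T) = 0"
    by (rule divergence_free_expectation[OF T])
  have "stopped_sum (partial_diff i v) T =
      (\<lambda>\<omega>. stopped_sum (\<lambda>S S'. w S' - w S) T \<omega> + stopped_sum g T \<omega>)"
    by (simp add: stopped_sum_def g_def fun_eq_iff flip: sum.distrib)
  then show "expectation (path_sum X i v T) = w T - w {}"
    unfolding eq using stopped_sum_expectation(1)[OF T] gradient_expectation[OF T] g by simp
qed

end

section \<open>Existence, uniqueness and representation\<close>

theorem theorem4p1:
  fixes U :: "'u set"
  assumes "countable U" and "infinite U"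
  shows "(\<exists>!\<Phi>. admissible_alloc U \<Phi>) \<and>
    (\<forall>\<Phi>. admissible_alloc U \<Phi> \<longrightarrow>
      (\<forall>N\<in>Fpow U. \<forall>(M :: 'a measure) X. N \<noteq> {} \<longrightarrow> random_coalition_process M N X \<longrightarrow>
        (\<forall>v\<in>games N. \<forall>i\<in>N. \<forall>T\<subseteq>N.
           integrable M (path_sum X i v T) \<and>
           \<Phi> N (v, T) i = prob_space.expectation M (path_sum X i v T))))"
proof (intro conjI allI impI ballI)
  show "\<exists>!\<Phi>. admissible_alloc U \<Phi>"
    using walsh_alloc_admissible admissible_alloc_unique by blast
  fix \<Phi> N and M :: "'a measure" and X v i T
  assume adm: "admissible_alloc U \<Phi>" and N: "N \<in> Fpow U" "N \<noteq> {}"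
    and X: "random_coalition_process M N X" and v: "v \<in> games N" and i: "i \<in> N" and T: "T \<subseteq> N"
  have fin: "finite N" using N(1) by (simp add: Fpow_def)
  interpret prob_space M using X by (simp add: random_coalition_process_def)
  interpret coalition_process M N X by unfold_locales (rule X fin N(2))+
  note path = path_sum_expectation[OF T i walsh_share_poisson[OF fin _ i], of v]
  show "integrable M (path_sum X i v T)" by (rule path(1))
  have "\<Phi> = walsh_alloc U" by (rule admissible_alloc_unique[OF adm walsh_alloc_admissible])
  \<comment> \<open>The potential \<open>walsh_share N v i\<close> vanishes at the starting point \<open>{}\<close>, so only its value at \<open>T\<close> remains.\<close>
  then show "\<Phi> N (v, T) i = expectation (path_sum X i v T)"
    using path(2) by (simp add: walsh_alloc_eq[OF N(1) v T i] walsh_share_empty)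
qed

end
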